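(* Let $S=\mathcal{M}[G;I,\Lambda;P]$ be a normalised Rees matrix semigroup. Then $S$ is homogeneous if and only if $G$ and $\langle E(S)\rangle$ are homogeneous and the set $G^P$ forms a characteristic subgroup of $G$.
   Context: All structures are countable. A semigroup is completely simple if it has no proper ideals and contains an idempotent $e$ such that, for every idempotent $f$, $ef=fe=f$ implies $f=e$. Every element $x$ of such a semigroup lies in a subgroup, and completely simple semigroups are regarded as unary semigroups with unary operation sending $x$ to its inverse in the maximal subgroup containing $x$; "finitely generated" (f.g.) and $\langle X\rangle$ refer to this signature. A completely simple semigroup is homogeneous if every isomorphism between its f.g. completely simple subsemigroups extends to an automorphism. A group is homogeneous if every isomorphism between f.g. subgroups extends to an automorphism. A subgroup is characteristic if it is preserved by all automorphisms. $E(S)$ is the set of idempotents of $S$; $\langle E(S)\rangle$ is a completely simple subsemigroup. For a group $G$ with identity $\epsilon$, non-empty sets $I,\Lambda$ and a $\Lambda\times I$ matrix $P=(p_{\lambda,i})$ over $G$, the Rees matrix semigroup $\mathcal{M}[G;I,\Lambda;P]$ is the (completely simple) semigroup $I\times G\times\Lambda$ with $(i,g,\lambda)(j,h,\mu)=(i,g\,p_{\lambda,j}h,\mu)$. It is normalised if there are distinguished $1_I\in I$, $1_\Lambda\in\Lambda$ with $p_{1_\Lambda,i}=\epsilon=p_{\lambda,1_I}$ for all $i,\lambda$. $G^P=\{p_{\lambda,i}:\lambda\in\Lambda,i\in I\}$. *)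

theory Defs
  imports "HOL-Algebra.Generated_Groups" "HOL-Library.Countable_Set"
begin

text \<open>HOL-Algebra has no carrier-based structure without a distinguished identity.\<close>

record 'a sgrp = "'a partial_object" +
  sprod :: "'a \<Rightarrow> 'a \<Rightarrow> 'a" (infixl "\<cdot>\<index>" 70)

definition is_semigroup :: "('a, 'b) sgrp_scheme \<Rightarrow> bool" where
  "is_semigroup S \<longleftrightarrow>
     (\<forall>x\<in>carrier S. \<forall>y\<in>carrier S. x \<cdot>\<^bsub>S\<^esub> y \<in> carrier S) \<and>
     (\<forall>x\<in>carrier S. \<forall>y\<in>carrier S. \<forall>z\<in>carrier S.
        (x \<cdot>\<^bsub>S\<^esub> y) \<cdot>\<^bsub>S\<^esub> z = x \<cdot>\<^bsub>S\<^esub> (y \<cdot>\<^bsub>S\<^esub> z))"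

definition idempotents :: "('a, 'b) sgrp_scheme \<Rightarrow> 'a set" where
  "idempotents S = {e \<in> carrier S. e \<cdot>\<^bsub>S\<^esub> e = e}"

text \<open>Ideals of a semigroup are non-empty by convention.\<close>

definition sgrp_ideal :: "('a, 'b) sgrp_scheme \<Rightarrow> 'a set \<Rightarrow> bool" where
  "sgrp_ideal S J \<longleftrightarrow> J \<noteq> {} \<and> J \<subseteq> carrier S \<and>
     (\<forall>s\<in>carrier S. \<forall>x\<in>J. s \<cdot>\<^bsub>S\<^esub> x \<in> J \<and> x \<cdot>\<^bsub>S\<^esub> s \<in> J)"

definition completely_simple :: "('a, 'b) sgrp_scheme \<Rightarrow> bool" where
  "completely_simple S \<longleftrightarrow> is_semigroup S \<and>
     (\<forall>J. sgrp_ideal S J \<longrightarrow> J = carrier S) \<and>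
     (\<exists>e\<in>idempotents S. \<forall>f\<in>idempotents S.
        e \<cdot>\<^bsub>S\<^esub> f = f \<and> f \<cdot>\<^bsub>S\<^esub> e = f \<longrightarrow> f = e)"

definition sgrp_iso :: "('a, 'c) sgrp_scheme \<Rightarrow> ('b, 'd) sgrp_scheme \<Rightarrow> ('a \<Rightarrow> 'b) set" where
  "sgrp_iso S T = {f. bij_betw f (carrier S) (carrier T) \<and>
     (\<forall>x\<in>carrier S. \<forall>y\<in>carrier S. f (x \<cdot>\<^bsub>S\<^esub> y) = f x \<cdot>\<^bsub>T\<^esub> f y)}"

text \<open>A subgroup of a semigroup may have any idempotent as its identity, so \<open>H\<close> with
  the identity \<open>e\<close> is made into a structure of HOL-Algebra.\<close>

definition group_at :: "('a, 'b) sgrp_scheme \<Rightarrow> 'a set \<Rightarrow> 'a \<Rightarrow> 'a monoid" where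
  "group_at S H e = \<lparr>carrier = H, mult = sprod S, one = e\<rparr>"

definition sgrp_subgroup :: "('a, 'b) sgrp_scheme \<Rightarrow> 'a set \<Rightarrow> bool" where
  "sgrp_subgroup S H \<longleftrightarrow> H \<subseteq> carrier S \<and> (\<exists>e. group (group_at S H e))"

definition maximal_subgroup :: "('a, 'b) sgrp_scheme \<Rightarrow> 'a set \<Rightarrow> bool" where
  "maximal_subgroup S H \<longleftrightarrow> sgrp_subgroup S H \<and>
     (\<forall>K. sgrp_subgroup S K \<and> H \<subseteq> K \<longrightarrow> K = H)"

definition sgrp_inv :: "('a, 'b) sgrp_scheme \<Rightarrow> 'a \<Rightarrow> 'a" where
  "sgrp_inv S x = (THE y. \<exists>H e. maximal_subgroup S H \<and> x \<in> H \<and>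
     group (group_at S H e) \<and> y = inv\<^bsub>group_at S H e\<^esub> x)"

inductive_set sgrp_generate :: "('a, 'b) sgrp_scheme \<Rightarrow> 'a set \<Rightarrow> 'a set"
  for S and X where
    incl: "x \<in> X \<Longrightarrow> x \<in> sgrp_generate S X"
  | prod: "x \<in> sgrp_generate S X \<Longrightarrow> y \<in> sgrp_generate S X \<Longrightarrow> x \<cdot>\<^bsub>S\<^esub> y \<in> sgrp_generate S X"
  | inv: "x \<in> sgrp_generate S X \<Longrightarrow> sgrp_inv S x \<in> sgrp_generate S X"

definition idempotent_generated :: "('a, 'b) sgrp_scheme \<Rightarrow> ('a, 'b) sgrp_scheme" where
  "idempotent_generated S = S\<lparr>carrier := sgrp_generate S (idempotents S)\<rparr>"

definition fg_cs_subsemigroup :: "('a, 'b) sgrp_scheme \<Rightarrow> 'a set \<Rightarrow> bool" where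
  "fg_cs_subsemigroup S A \<longleftrightarrow> completely_simple (S\<lparr>carrier := A\<rparr>) \<and>
     (\<exists>X. finite X \<and> X \<subseteq> carrier S \<and> A = sgrp_generate S X)"

text \<open>Homomorphisms of completely simple semigroups commute with the unary operation,
  so \<^const>\<open>sgrp_iso\<close> gives the isomorphisms of unary semigroups.\<close>

definition homogeneous_cs :: "('a, 'b) sgrp_scheme \<Rightarrow> bool" where
  "homogeneous_cs S \<longleftrightarrow> completely_simple S \<and>
     (\<forall>A B. \<forall>\<theta> \<in> sgrp_iso (S\<lparr>carrier := A\<rparr>) (S\<lparr>carrier := B\<rparr>).
        fg_cs_subsemigroup S A \<and> fg_cs_subsemigroup S B \<longrightarrow>
        (\<exists>\<phi> \<in> sgrp_iso S S. \<forall>x\<in>A. \<phi> x = \<theta> x))"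

definition fg_subgroup :: "('a, 'b) monoid_scheme \<Rightarrow> 'a set \<Rightarrow> bool" where
  "fg_subgroup G A \<longleftrightarrow> (\<exists>X. finite X \<and> X \<subseteq> carrier G \<and> A = generate G X)"

definition homogeneous_group :: "('a, 'b) monoid_scheme \<Rightarrow> bool" where
  "homogeneous_group G \<longleftrightarrow> group G \<and>
     (\<forall>A B. \<forall>\<theta> \<in> iso (G\<lparr>carrier := A\<rparr>) (G\<lparr>carrier := B\<rparr>).
        fg_subgroup G A \<and> fg_subgroup G B \<longrightarrow>
        (\<exists>\<phi> \<in> iso G G. \<forall>x\<in>A. \<phi> x = \<theta> x))"

definition characteristic_subgroup :: "'a set \<Rightarrow> ('a, 'b) monoid_scheme \<Rightarrow> bool" where
  "characteristic_subgroup H G \<longleftrightarrow> subgroup H G \<and> (\<forall>\<phi> \<in> iso G G. \<phi> ` H = H)"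

definition rees_matrix_semigroup ::
  "('g, 'b) monoid_scheme \<Rightarrow> 'i set \<Rightarrow> 'l set \<Rightarrow> ('l \<Rightarrow> 'i \<Rightarrow> 'g) \<Rightarrow> ('i \<times> 'g \<times> 'l) sgrp" where
  "rees_matrix_semigroup G I \<Lambda> P =
     \<lparr>carrier = I \<times> carrier G \<times> \<Lambda>,
      sprod = (\<lambda>(i, g, l) (j, h, m). (i, g \<otimes>\<^bsub>G\<^esub> P l j \<otimes>\<^bsub>G\<^esub> h, m))\<rparr>"

definition normalised ::
  "('g, 'b) monoid_scheme \<Rightarrow> 'i set \<Rightarrow> 'l set \<Rightarrow> ('l \<Rightarrow> 'i \<Rightarrow> 'g) \<Rightarrow> bool" where
  "normalised G I \<Lambda> P \<longleftrightarrow> (\<exists>i\<^sub>1\<in>I. \<exists>l\<^sub>1\<in>\<Lambda>.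
     (\<forall>i\<in>I. P l\<^sub>1 i = \<one>\<^bsub>G\<^esub>) \<and> (\<forall>l\<in>\<Lambda>. P l i\<^sub>1 = \<one>\<^bsub>G\<^esub>))"

definition matrix_entries :: "'i set \<Rightarrow> 'l set \<Rightarrow> ('l \<Rightarrow> 'i \<Rightarrow> 'g) \<Rightarrow> 'g set" where
  "matrix_entries I \<Lambda> P = {P l i | l i. l \<in> \<Lambda> \<and> i \<in> I}"

end

theory Submission
  imports Defs
begin

text \<open>An isomorphism between Rees matrix semigroups which are normalised at \<open>(i\<^sub>0, l\<^sub>0)\<close> and
  \<open>(j\<^sub>0, m\<^sub>0)\<close>, and which matches the corresponding idempotents, is a triple of bijections of the
  two index sets and an isomorphism of groups that carries one matrix to the other.

  If \<open>S\<close> is homogeneous, then extending isomorphisms between subsemigroups \<open>{i\<^sub>1} \<times> A \<times> {l\<^sub>1}\<close>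
  shows that \<open>G\<close> is homogeneous and that the set of entries is invariant under
  automorphisms of \<open>G\<close>. Moving rows around a fixed cyclic group shows that every row other
  than \<open>l\<^sub>1\<close> contains all entries, and renormalising the matrix at \<open>(i, l\<^sub>1)\<close> shows that
  the quotient of two entries in the same row is an entry; hence the entries form a subgroup \<open>N\<close>,
  and \<open>\<langle>E(S)\<rangle>\<close> is the Rees matrix semigroup over \<open>N\<close>.

  Conversely, an isomorphism \<open>\<theta>\<close> between finitely generated subsemigroups of \<open>S\<close> becomes, after
  renormalising the matrix at an idempotent of the domain and at its image, an isomorphism between
  boxes \<open>J \<times> H \<times> K\<close> with \<open>J\<close>, \<open>K\<close> finite and \<open>H\<close> finitely generated. Its group part extends to an
  automorphism \<open>\<beta>\<close> of \<open>G\<close>, which preserves \<open>N\<close>. Keeping \<open>\<beta>\<close> fixed, the two index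
  maps are extended by back-and-forth: a single step only involves a finitely generated subgroup of
  \<open>N\<close>, so homogeneity of \<open>\<langle>E(S)\<rangle>\<close> provides the images of the new indices.\<close>

subsection \<open>Isomorphisms and generation in completely regular semigroups\<close>

text \<open>Captures by equations alone what the unary operation needs: a commuting inverse is
  unique, so it can be carried along isomorphisms without mentioning maximal subgroups.\<close>

definition completely_regular :: "('a, 'b) sgrp_scheme \<Rightarrow> bool" where
  "completely_regular S \<longleftrightarrow> is_semigroup S \<and>
     (\<forall>x\<in>carrier S. \<exists>y\<in>carrier S. x \<cdot>\<^bsub>S\<^esub> y \<cdot>\<^bsub>S\<^esub> x = x \<and> y \<cdot>\<^bsub>S\<^esub> x \<cdot>\<^bsub>S\<^esub> y = y \<and>
        x \<cdot>\<^bsub>S\<^esub> y = y \<cdot>\<^bsub>S\<^esub> x)"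

lemma semigroup_closed:
  "is_semigroup S \<Longrightarrow> x \<in> carrier S \<Longrightarrow> y \<in> carrier S \<Longrightarrow> x \<cdot>\<^bsub>S\<^esub> y \<in> carrier S"
  by (simp add: is_semigroup_def)

lemma semigroup_assoc:
  "is_semigroup S \<Longrightarrow> x \<in> carrier S \<Longrightarrow> y \<in> carrier S \<Longrightarrow> z \<in> carrier S \<Longrightarrow>
    x \<cdot>\<^bsub>S\<^esub> y \<cdot>\<^bsub>S\<^esub> z = x \<cdot>\<^bsub>S\<^esub> (y \<cdot>\<^bsub>S\<^esub> z)"
  by (simp add: is_semigroup_def)

lemma group_atD:
  assumes "group (group_at S H e)"
  shows "e \<in> H" "\<And>x y. x \<in> H \<Longrightarrow> y \<in> H \<Longrightarrow> x \<cdot>\<^bsub>S\<^esub> y \<in> H"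
    "\<And>x. x \<in> H \<Longrightarrow> e \<cdot>\<^bsub>S\<^esub> x = x" "\<And>x. x \<in> H \<Longrightarrow> x \<cdot>\<^bsub>S\<^esub> e = x"
    "\<And>x. x \<in> H \<Longrightarrow> inv\<^bsub>group_at S H e\<^esub> x \<in> H"
    "\<And>x. x \<in> H \<Longrightarrow> x \<cdot>\<^bsub>S\<^esub> inv\<^bsub>group_at S H e\<^esub> x = e"
    "\<And>x. x \<in> H \<Longrightarrow> inv\<^bsub>group_at S H e\<^esub> x \<cdot>\<^bsub>S\<^esub> x = e"
proof -
  interpret group "group_at S H e" by fact
  show "e \<in> H" "\<And>x y. x \<in> H \<Longrightarrow> y \<in> H \<Longrightarrow> x \<cdot>\<^bsub>S\<^esub> y \<in> H"
    "\<And>x. x \<in> H \<Longrightarrow> e \<cdot>\<^bsub>S\<^esub> x = x" "\<And>x. x \<in> H \<Longrightarrow> x \<cdot>\<^bsub>S\<^esub> e = x"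
    "\<And>x. x \<in> H \<Longrightarrow> inv\<^bsub>group_at S H e\<^esub> x \<in> H"
    "\<And>x. x \<in> H \<Longrightarrow> x \<cdot>\<^bsub>S\<^esub> inv\<^bsub>group_at S H e\<^esub> x = e"
    "\<And>x. x \<in> H \<Longrightarrow> inv\<^bsub>group_at S H e\<^esub> x \<cdot>\<^bsub>S\<^esub> x = e"
    using one_closed m_closed l_one r_one inv_closed r_inv l_inv by (auto simp: group_at_def)
qed

section \<open>Maximal subgroups and the unary operation\<close>

text \<open>The group of units of the local monoid \<open>e S e\<close>, where
  \<open>e = x y\<close>, contains \<open>x\<close>. A larger subgroup contains the idempotent
  \<open>e\<close>, which must be its identity, so its elements are again units of
  \<open>e S e\<close>.\<close>

lemma maximal_subgroup_exists:
  assumes S: "is_semigroup S" and x: "x \<in> carrier S" and y: "y \<in> carrier S"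
    and xyx: "x \<cdot>\<^bsub>S\<^esub> y \<cdot>\<^bsub>S\<^esub> x = x" and yxy: "y \<cdot>\<^bsub>S\<^esub> x \<cdot>\<^bsub>S\<^esub> y = y"
    and comm: "x \<cdot>\<^bsub>S\<^esub> y = y \<cdot>\<^bsub>S\<^esub> x"
  shows "\<exists>H. maximal_subgroup S H \<and> x \<in> H \<and> group (group_at S H (x \<cdot>\<^bsub>S\<^esub> y))"
proof -
  note [simp] = semigroup_closed[OF S] semigroup_assoc[OF S]
  define e where "e = x \<cdot>\<^bsub>S\<^esub> y"
  have eS [simp]: "e \<in> carrier S" using x y by (simp add: e_def)
  have ee [simp]: "e \<cdot>\<^bsub>S\<^esub> e = e" using x y yxy by (simp add: e_def)
  define H where "H = {u \<in> carrier S. e \<cdot>\<^bsub>S\<^esub> u = u \<and> u \<cdot>\<^bsub>S\<^esub> e = u \<and>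
    (\<exists>v\<in>carrier S. e \<cdot>\<^bsub>S\<^esub> v = v \<and> v \<cdot>\<^bsub>S\<^esub> e = v \<and> u \<cdot>\<^bsub>S\<^esub> v = e \<and> v \<cdot>\<^bsub>S\<^esub> u = e)}"
  have xH: "x \<in> H"
    unfolding H_def using x y xyx yxy comm
    by (auto simp: e_def intro!: bexI[of _ y]) (metis S semigroup_assoc)+
  have closed: "u \<cdot>\<^bsub>S\<^esub> w \<in> H" if "u \<in> H" "w \<in> H" for u w
  proof -
    obtain u' where u': "u' \<in> carrier S" "e \<cdot>\<^bsub>S\<^esub> u' = u'" "u' \<cdot>\<^bsub>S\<^esub> e = u'" "u \<cdot>\<^bsub>S\<^esub> u' = e" "u' \<cdot>\<^bsub>S\<^esub> u = e"
      using \<open>u \<in> H\<close> by (auto simp: H_def)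
    obtain w' where w': "w' \<in> carrier S" "e \<cdot>\<^bsub>S\<^esub> w' = w'" "w' \<cdot>\<^bsub>S\<^esub> e = w'" "w \<cdot>\<^bsub>S\<^esub> w' = e" "w' \<cdot>\<^bsub>S\<^esub> w = e"
      using \<open>w \<in> H\<close> by (auto simp: H_def)
    have u: "u \<in> carrier S" "e \<cdot>\<^bsub>S\<^esub> u = u" "u \<cdot>\<^bsub>S\<^esub> e = u" using that by (auto simp: H_def)
    have w: "w \<in> carrier S" "e \<cdot>\<^bsub>S\<^esub> w = w" "w \<cdot>\<^bsub>S\<^esub> e = w" using that by (auto simp: H_def)
    have 1: "u \<cdot>\<^bsub>S\<^esub> w \<cdot>\<^bsub>S\<^esub> (w' \<cdot>\<^bsub>S\<^esub> u') = e"
      using u w u' w' semigroup_assoc[OF S] semigroup_closed[OF S] by metis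
    have 2: "w' \<cdot>\<^bsub>S\<^esub> u' \<cdot>\<^bsub>S\<^esub> (u \<cdot>\<^bsub>S\<^esub> w) = e"
      using u w u' w' semigroup_assoc[OF S] semigroup_closed[OF S] by metis
    have 3: "e \<cdot>\<^bsub>S\<^esub> (u \<cdot>\<^bsub>S\<^esub> w) = u \<cdot>\<^bsub>S\<^esub> w" "e \<cdot>\<^bsub>S\<^esub> (w' \<cdot>\<^bsub>S\<^esub> u') = w' \<cdot>\<^bsub>S\<^esub> u'"
      using u w u' w' semigroup_assoc[OF S eS] by metis+
    have 4: "u \<cdot>\<^bsub>S\<^esub> w \<cdot>\<^bsub>S\<^esub> e = u \<cdot>\<^bsub>S\<^esub> w" "w' \<cdot>\<^bsub>S\<^esub> u' \<cdot>\<^bsub>S\<^esub> e = w' \<cdot>\<^bsub>S\<^esub> u'"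
      using u w u' w' by simp_all
    show ?thesis
      unfolding H_def using 1 2 3 4 u(1) w(1) u'(1) w'(1)
      by (intro CollectI conjI bexI[of _ "w' \<cdot>\<^bsub>S\<^esub> u'"]) (simp_all del: semigroup_assoc[OF S])
  qed
  have G: "group (group_at S H e)"
  proof (rule groupI)
    fix u assume "u \<in> carrier (group_at S H e)"
    then have u: "u \<in> H" by (simp add: group_at_def)
    then obtain v where "v \<in> carrier S" "e \<cdot>\<^bsub>S\<^esub> v = v" "v \<cdot>\<^bsub>S\<^esub> e = v" "u \<cdot>\<^bsub>S\<^esub> v = e" "v \<cdot>\<^bsub>S\<^esub> u = e"
      by (auto simp: H_def)
    then have "v \<in> H \<and> v \<cdot>\<^bsub>S\<^esub> u = e" using u by (auto simp: H_def)
    then show "\<exists>v\<in>carrier (group_at S H e). v \<otimes>\<^bsub>group_at S H e\<^esub> u = \<one>\<^bsub>group_at S H e\<^esub>"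
      by (auto simp: group_at_def)
  next
    show "\<one>\<^bsub>group_at S H e\<^esub> \<in> carrier (group_at S H e)"
      by (auto simp: group_at_def H_def intro!: bexI[of _ e])
  next
    fix u v w
    assume "u \<in> carrier (group_at S H e)" "v \<in> carrier (group_at S H e)"
      "w \<in> carrier (group_at S H e)"
    then show "u \<otimes>\<^bsub>group_at S H e\<^esub> v \<otimes>\<^bsub>group_at S H e\<^esub> w =
      u \<otimes>\<^bsub>group_at S H e\<^esub> (v \<otimes>\<^bsub>group_at S H e\<^esub> w)"
      by (simp add: group_at_def H_def)
  qed (use closed in \<open>auto simp: group_at_def H_def\<close>)
  moreover have "K = H" if K: "sgrp_subgroup S K" "H \<subseteq> K" for K
  proof -
    obtain f where KS: "K \<subseteq> carrier S" and f: "group (group_at S K f)"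
      using K(1) by (auto simp: sgrp_subgroup_def)
    note K' = group_atD[OF f]
    have eK: "e \<in> K" using group_atD(1)[OF G] K(2) by auto
    \<comment> \<open>Cancelling in \<open>e e = e\<close> inside the group \<open>K\<close>
      identifies its identity \<open>f\<close> with \<open>e\<close>.\<close>
    have "f = e \<cdot>\<^bsub>S\<^esub> inv\<^bsub>group_at S K f\<^esub> e" using K'(6) eK by simp
    also have "\<dots> = e \<cdot>\<^bsub>S\<^esub> e \<cdot>\<^bsub>S\<^esub> inv\<^bsub>group_at S K f\<^esub> e" by simp
    also have "\<dots> = e \<cdot>\<^bsub>S\<^esub> (e \<cdot>\<^bsub>S\<^esub> inv\<^bsub>group_at S K f\<^esub> e)"
      using KS K'(5) eK by (intro semigroup_assoc[OF S]) auto
    also have "\<dots> = e" using K'(4,6) eK by simp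
    finally have fe: "f = e" .
    have "K \<subseteq> H"
    proof
      fix u assume u: "u \<in> K"
      then show "u \<in> H"
        unfolding H_def using K' KS by (auto simp: fe intro!: bexI[of _ "inv\<^bsub>group_at S K e\<^esub> u"])
    qed
    then show ?thesis using K(2) by auto
  qed
  ultimately have "maximal_subgroup S H"
    by (auto simp: maximal_subgroup_def sgrp_subgroup_def H_def)
  then show ?thesis using xH G unfolding e_def by blast
qed

text \<open>Any subgroup containing \<open>x\<close>, with identity \<open>f\<close> and inverse
  \<open>z\<close> of \<open>x\<close>, satisfies \<open>f = y x\<close> and hence
  \<open>z = y\<close>. So every candidate in the definite description equals \<open>y\<close>, and
  \<open>maximal_subgroup_exists\<close> provides one.\<close>

lemma sgrp_inv_eqI:
  assumes S: "is_semigroup S" and x: "x \<in> carrier S" and y: "y \<in> carrier S"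
    and xyx: "x \<cdot>\<^bsub>S\<^esub> y \<cdot>\<^bsub>S\<^esub> x = x" and yxy: "y \<cdot>\<^bsub>S\<^esub> x \<cdot>\<^bsub>S\<^esub> y = y"
    and comm: "x \<cdot>\<^bsub>S\<^esub> y = y \<cdot>\<^bsub>S\<^esub> x"
  shows "sgrp_inv S x = y"
proof -
  have unique: "z = y" if "sgrp_subgroup S H" "x \<in> H" and g: "group (group_at S H f)"
    and z: "z = inv\<^bsub>group_at S H f\<^esub> x" for H f z
  proof -
    note H = group_atD[OF g]
    have HS: "H \<subseteq> carrier S" using that by (simp add: sgrp_subgroup_def)
    have zS: "z \<in> carrier S" "f \<in> carrier S" using H \<open>x \<in> H\<close> HS z by auto
    have xz: "x \<cdot>\<^bsub>S\<^esub> z = f" "z \<cdot>\<^bsub>S\<^esub> x = f" using H \<open>x \<in> H\<close> z by auto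
    have fx: "f \<cdot>\<^bsub>S\<^esub> x = x" "x \<cdot>\<^bsub>S\<^esub> f = x" "f \<cdot>\<^bsub>S\<^esub> z = z" using H \<open>x \<in> H\<close> z by auto
    \<comment> \<open>The chain is \<open>f = x z = x y x z = x y f\<close>; commutation and
      \<open>x f = x\<close> then remove the last \<open>f\<close>.\<close>
    have "f = x \<cdot>\<^bsub>S\<^esub> y \<cdot>\<^bsub>S\<^esub> f"
      using xyx xz(1) semigroup_assoc[OF S] semigroup_closed[OF S] x y zS by metis
    also have "\<dots> = y \<cdot>\<^bsub>S\<^esub> x"
      using comm fx(2) semigroup_assoc[OF S] x y zS by metis
    finally have f: "f = y \<cdot>\<^bsub>S\<^esub> x" .
    have "z = f \<cdot>\<^bsub>S\<^esub> z" using fx by simp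
    also have "\<dots> = y \<cdot>\<^bsub>S\<^esub> f" using f xz(1) semigroup_assoc[OF S] x y zS by metis
    also have "\<dots> = y" using f yxy comm semigroup_assoc[OF S] x y by metis
    finally show ?thesis .
  qed
  show ?thesis
    unfolding sgrp_inv_def
  proof (rule the_equality)
    obtain H where H: "maximal_subgroup S H" "x \<in> H" "group (group_at S H (x \<cdot>\<^bsub>S\<^esub> y))"
      using maximal_subgroup_exists[OF assms] by blast
    then show "\<exists>H e. maximal_subgroup S H \<and> x \<in> H \<and> group (group_at S H e) \<and>
        y = inv\<^bsub>group_at S H e\<^esub> x"
      using unique by (metis maximal_subgroup_def)
  qed (use unique in \<open>auto simp: maximal_subgroup_def\<close>)
qed

lemma completely_regular_inv:
  assumes "completely_regular S" "x \<in> carrier S"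
  shows "sgrp_inv S x \<in> carrier S" "x \<cdot>\<^bsub>S\<^esub> sgrp_inv S x \<cdot>\<^bsub>S\<^esub> x = x"
    "sgrp_inv S x \<cdot>\<^bsub>S\<^esub> x \<cdot>\<^bsub>S\<^esub> sgrp_inv S x = sgrp_inv S x"
    "x \<cdot>\<^bsub>S\<^esub> sgrp_inv S x = sgrp_inv S x \<cdot>\<^bsub>S\<^esub> x"
proof -
  obtain y where y: "y \<in> carrier S" "x \<cdot>\<^bsub>S\<^esub> y \<cdot>\<^bsub>S\<^esub> x = x" "y \<cdot>\<^bsub>S\<^esub> x \<cdot>\<^bsub>S\<^esub> y = y" "x \<cdot>\<^bsub>S\<^esub> y = y \<cdot>\<^bsub>S\<^esub> x"
    using assms by (auto simp: completely_regular_def)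
  moreover have "sgrp_inv S x = y"
    using assms y by (intro sgrp_inv_eqI) (auto simp: completely_regular_def)
  ultimately show "sgrp_inv S x \<in> carrier S" "x \<cdot>\<^bsub>S\<^esub> sgrp_inv S x \<cdot>\<^bsub>S\<^esub> x = x"
    "sgrp_inv S x \<cdot>\<^bsub>S\<^esub> x \<cdot>\<^bsub>S\<^esub> sgrp_inv S x = sgrp_inv S x"
    "x \<cdot>\<^bsub>S\<^esub> sgrp_inv S x = sgrp_inv S x \<cdot>\<^bsub>S\<^esub> x"
    by simp_all
qed

lemma completely_regular_semigroup: "completely_regular S \<Longrightarrow> is_semigroup S"
  by (simp add: completely_regular_def)

lemma sgrp_generate_subset:
  assumes "X \<subseteq> A" "\<And>x y. x \<in> A \<Longrightarrow> y \<in> A \<Longrightarrow> x \<cdot>\<^bsub>S\<^esub> y \<in> A" "\<And>x. x \<in> A \<Longrightarrow> sgrp_inv S x \<in> A"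
  shows "sgrp_generate S X \<subseteq> A"
proof
  fix x assume "x \<in> sgrp_generate S X"
  then show "x \<in> A" by induction (use assms in auto)
qed

lemma sgrp_generate_carrier:
  assumes "completely_regular S" "X \<subseteq> carrier S"
  shows "sgrp_generate S X \<subseteq> carrier S"
  using assms(2) completely_regular_inv(1)[OF assms(1)]
    semigroup_closed[OF completely_regular_semigroup[OF assms(1)]]
  by (intro sgrp_generate_subset) simp_all

section \<open>Transport of structure along isomorphisms\<close>

lemma sgrp_isoD:
  assumes "f \<in> sgrp_iso S T"
  shows "bij_betw f (carrier S) (carrier T)"
    "\<And>x. x \<in> carrier S \<Longrightarrow> f x \<in> carrier T"
    "\<And>x y. x \<in> carrier S \<Longrightarrow> y \<in> carrier S \<Longrightarrow> f (x \<cdot>\<^bsub>S\<^esub> y) = f x \<cdot>\<^bsub>T\<^esub> f y"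
    "inj_on f (carrier S)" "f ` carrier S = carrier T"
  using assms by (auto simp: sgrp_iso_def bij_betw_def)

lemma sgrp_iso_inv_into:
  assumes "is_semigroup S" "f \<in> sgrp_iso S T"
  shows "inv_into (carrier S) f \<in> sgrp_iso T S"
proof -
  note f = sgrp_isoD[OF assms(2)]
  have "inv_into (carrier S) f (x \<cdot>\<^bsub>T\<^esub> y) = inv_into (carrier S) f x \<cdot>\<^bsub>S\<^esub> inv_into (carrier S) f y"
    if "x \<in> carrier T" "y \<in> carrier T" for x y
  proof (rule inv_into_f_eq[OF f(4)])
    have *: "inv_into (carrier S) f x \<in> carrier S" "inv_into (carrier S) f y \<in> carrier S"
      using that f(5) inv_into_into[of _ f "carrier S"] by metis+
    then show "inv_into (carrier S) f x \<cdot>\<^bsub>S\<^esub> inv_into (carrier S) f y \<in> carrier S"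
      by (rule semigroup_closed[OF assms(1)])
    show "f (inv_into (carrier S) f x \<cdot>\<^bsub>S\<^esub> inv_into (carrier S) f y) = x \<cdot>\<^bsub>T\<^esub> y"
      using f(3)[OF *] that f(5) f_inv_into_f[of _ f "carrier S"] by metis
  qed
  then show ?thesis
    using f(1) by (auto simp: sgrp_iso_def bij_betw_inv_into)
qed

lemma sgrp_iso_compose:
  assumes "f \<in> sgrp_iso S T" "g \<in> sgrp_iso T U"
  shows "g \<circ> f \<in> sgrp_iso S U"
  using assms sgrp_isoD[OF assms(1)] sgrp_isoD[OF assms(2)]
  by (auto simp: sgrp_iso_def intro: bij_betw_trans)

lemma sgrp_iso_restrict:
  assumes "f \<in> sgrp_iso S T" "A \<subseteq> carrier S"
  shows "f \<in> sgrp_iso (S\<lparr>carrier := A\<rparr>) (T\<lparr>carrier := f ` A\<rparr>)"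
  using sgrp_isoD(3,4)[OF assms(1)] subsetD[OF assms(2)]
  by (auto simp: sgrp_iso_def bij_betw_def inj_on_def)

lemma sgrp_iso_semigroup:
  assumes "is_semigroup S" "f \<in> sgrp_iso S T"
  shows "is_semigroup T"
proof -
  note f = sgrp_isoD[OF assms(2)]
  have "f x \<cdot>\<^bsub>T\<^esub> f y \<in> carrier T" if "x \<in> carrier S" "y \<in> carrier S" for x y
    using f(2,3) semigroup_closed[OF assms(1)] that by metis
  moreover have "f x \<cdot>\<^bsub>T\<^esub> f y \<cdot>\<^bsub>T\<^esub> f z = f x \<cdot>\<^bsub>T\<^esub> (f y \<cdot>\<^bsub>T\<^esub> f z)"
    if "x \<in> carrier S" "y \<in> carrier S" "z \<in> carrier S" for x y z
    using f(3) semigroup_closed[OF assms(1)] semigroup_assoc[OF assms(1)] that by metis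
  ultimately show ?thesis by (auto simp: is_semigroup_def simp flip: f(5))
qed

lemma sgrp_iso_idempotents:
  assumes S: "is_semigroup S" and f: "f \<in> sgrp_iso S T"
  shows "f ` idempotents S = idempotents T"
proof -
  note f = sgrp_isoD[OF f]
  have "f x \<in> idempotents T \<longleftrightarrow> x \<in> idempotents S" if "x \<in> carrier S" for x
    using f(2) that inj_on_eq_iff[OF f(4), of "x \<cdot>\<^bsub>S\<^esub> x" x] semigroup_closed[OF S] f(3)
    by (auto simp: idempotents_def)
  moreover have "idempotents S \<subseteq> carrier S" "idempotents T \<subseteq> f ` carrier S"
    using f(5) by (auto simp: idempotents_def)
  ultimately show ?thesis by blast
qed

text \<open>The equations that characterise the inverse involve only the multiplication, which
  \<open>f\<close> preserves.\<close>

lemma sgrp_iso_inv: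
  assumes S: "completely_regular S" and f: "f \<in> sgrp_iso S T" and x: "x \<in> carrier S"
  shows "f (sgrp_inv S x) = sgrp_inv T (f x)"
proof -
  note f' = sgrp_isoD[OF f] and c = completely_regular_inv[OF S x]
  have S': "is_semigroup S" using S by (rule completely_regular_semigroup)
  have "f x \<cdot>\<^bsub>T\<^esub> f (sgrp_inv S x) \<cdot>\<^bsub>T\<^esub> f x = f x"
    using c(2) f'(3) semigroup_closed[OF S'] x c(1) by metis
  moreover have "f (sgrp_inv S x) \<cdot>\<^bsub>T\<^esub> f x \<cdot>\<^bsub>T\<^esub> f (sgrp_inv S x) = f (sgrp_inv S x)"
    using c(3) f'(3) semigroup_closed[OF S'] x c(1) by metis
  moreover have "f x \<cdot>\<^bsub>T\<^esub> f (sgrp_inv S x) = f (sgrp_inv S x) \<cdot>\<^bsub>T\<^esub> f x"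
    using c(4) f'(3) x c(1) by metis
  ultimately show ?thesis
    using sgrp_inv_eqI[OF sgrp_iso_semigroup[OF S' f]] f'(2) x c(1) by metis
qed

lemma sgrp_iso_generate:
  assumes S: "completely_regular S" and f: "f \<in> sgrp_iso S T" and X: "X \<subseteq> carrier S"
  shows "f ` sgrp_generate S X = sgrp_generate T (f ` X)"
proof
  note f' = sgrp_isoD[OF f] and c = sgrp_generate_carrier[OF S X]
  show "f ` sgrp_generate S X \<subseteq> sgrp_generate T (f ` X)"
  proof
    fix y assume "y \<in> f ` sgrp_generate S X"
    then obtain x where "x \<in> sgrp_generate S X" and y: "y = f x" by auto
    from this(1) have "f x \<in> sgrp_generate T (f ` X)"
    proof induction
      case (prod x y)
      then have "f (x \<cdot>\<^bsub>S\<^esub> y) = f x \<cdot>\<^bsub>T\<^esub> f y" using c f'(3) by auto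
      then show ?case using prod sgrp_generate.prod by metis
    next
      case (inv x)
      then have "f (sgrp_inv S x) = sgrp_inv T (f x)" using c sgrp_iso_inv[OF S f] by auto
      then show ?case using inv sgrp_generate.inv by metis
    qed (auto intro: sgrp_generate.incl)
    then show "y \<in> sgrp_generate T (f ` X)" using y by simp
  qed
  show "sgrp_generate T (f ` X) \<subseteq> f ` sgrp_generate S X"
  proof (rule sgrp_generate_subset)
    fix y assume "y \<in> f ` sgrp_generate S X"
    then obtain x where x: "x \<in> sgrp_generate S X" "y = f x" by auto
    then have "sgrp_inv T y = f (sgrp_inv S x)" using c sgrp_iso_inv[OF S f] by auto
    then show "sgrp_inv T y \<in> f ` sgrp_generate S X"
      using sgrp_generate.inv[OF x(1)] by auto
  next
    fix y y' assume "y \<in> f ` sgrp_generate S X" "y' \<in> f ` sgrp_generate S X"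
    then obtain x x' where x: "x \<in> sgrp_generate S X" "y = f x"
      "x' \<in> sgrp_generate S X" "y' = f x'" by auto
    then have "y \<cdot>\<^bsub>T\<^esub> y' = f (x \<cdot>\<^bsub>S\<^esub> x')" using f'(3) subsetD[OF c] by simp
    then show "y \<cdot>\<^bsub>T\<^esub> y' \<in> f ` sgrp_generate S X"
      using sgrp_generate.prod[OF x(1,3)] by auto
  qed (auto intro: sgrp_generate.incl)
qed

text \<open>Ideals pull back along \<open>f\<close>, and a primitive idempotent maps to a primitive
  one because \<open>f\<close> is injective and matches the idempotents.\<close>

lemma sgrp_iso_completely_simple:
  assumes S: "completely_simple S" and f: "f \<in> sgrp_iso S T"
  shows "completely_simple T"
  unfolding completely_simple_def
proof (intro conjI allI impI)
  have S': "is_semigroup S" using S by (simp add: completely_simple_def)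
  show T: "is_semigroup T" using sgrp_iso_semigroup[OF S' f] .
  note f' = sgrp_isoD[OF f]
  {
    fix J assume J: "sgrp_ideal T J"
    define K where "K = {x \<in> carrier S. f x \<in> J}"
    have img: "f ` K = J" using J f'(5) by (auto simp: K_def sgrp_ideal_def)
    have "sgrp_ideal S K"
      unfolding sgrp_ideal_def
    proof (intro conjI ballI)
      show "K \<noteq> {}" using img J by (auto simp: sgrp_ideal_def)
    qed (use J f' semigroup_closed[OF S'] in \<open>auto simp: K_def sgrp_ideal_def\<close>)
    then have "K = carrier S" using S by (simp add: completely_simple_def)
    then show "J = carrier T" using img f'(5) by simp
  }
  obtain e where e: "e \<in> idempotents S"
    "\<And>g. g \<in> idempotents S \<Longrightarrow> e \<cdot>\<^bsub>S\<^esub> g = g \<Longrightarrow> g \<cdot>\<^bsub>S\<^esub> e = g \<Longrightarrow> g = e"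
    using S by (auto simp: completely_simple_def)
  have I: "idempotents T = f ` idempotents S" using sgrp_iso_idempotents[OF S' f] by simp
  have "\<forall>g\<in>idempotents S. f e \<cdot>\<^bsub>T\<^esub> f g = f g \<and> f g \<cdot>\<^bsub>T\<^esub> f e = f g \<longrightarrow> f g = f e"
  proof (intro ballI impI)
    fix g assume g: "g \<in> idempotents S" and *: "f e \<cdot>\<^bsub>T\<^esub> f g = f g \<and> f g \<cdot>\<^bsub>T\<^esub> f e = f g"
    have "e \<in> carrier S" "g \<in> carrier S" using g e by (auto simp: idempotents_def)
    then have "e \<cdot>\<^bsub>S\<^esub> g = g" "g \<cdot>\<^bsub>S\<^esub> e = g"
      using * f'(3) inj_onD[OF f'(4)] semigroup_closed[OF S'] by metis+
    then show "f g = f e" using e(2)[OF g] by blast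
  qed
  then show "\<exists>e\<in>idempotents T. \<forall>g\<in>idempotents T. e \<cdot>\<^bsub>T\<^esub> g = g \<and> g \<cdot>\<^bsub>T\<^esub> e = g \<longrightarrow> g = e"
    unfolding I using e(1) by auto
qed

lemma fg_cs_subsemigroup_subset:
  "completely_regular S \<Longrightarrow> fg_cs_subsemigroup S A \<Longrightarrow> A \<subseteq> carrier S"
  using sgrp_generate_carrier by (auto simp: fg_cs_subsemigroup_def)

lemma sgrp_iso_fg_cs_subsemigroup:
  assumes S: "completely_regular S" and f: "f \<in> sgrp_iso S T" and A: "fg_cs_subsemigroup S A"
  shows "fg_cs_subsemigroup T (f ` A)"
proof -
  obtain X where X: "finite X" "X \<subseteq> carrier S" "A = sgrp_generate S X"
    using A by (auto simp: fg_cs_subsemigroup_def)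
  have "f ` A = sgrp_generate T (f ` X)" using X sgrp_iso_generate[OF S f] by simp
  moreover have "f ` X \<subseteq> carrier T" using X sgrp_isoD(2)[OF f] by auto
  moreover have "completely_simple (T\<lparr>carrier := f ` A\<rparr>)"
    using A sgrp_iso_restrict[OF f fg_cs_subsemigroup_subset[OF S A]]
    by (auto simp: fg_cs_subsemigroup_def intro: sgrp_iso_completely_simple)
  ultimately show ?thesis using X(1) by (auto simp: fg_cs_subsemigroup_def)
qed

lemma homogeneous_csD:
  assumes "homogeneous_cs S" "\<theta> \<in> sgrp_iso (S\<lparr>carrier := A\<rparr>) (S\<lparr>carrier := B\<rparr>)"
    "fg_cs_subsemigroup S A" "fg_cs_subsemigroup S B"
  shows "\<exists>\<phi>\<in>sgrp_iso S S. \<forall>x\<in>A. \<phi> x = \<theta> x"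
  using assms unfolding homogeneous_cs_def by blast

text \<open>Intended for two renormalised copies of one semigroup \<open>T\<close>, the first for
  the domain and the second for the image of \<open>\<theta>\<close>: conjugating by
  \<open>f\<close> and \<open>g\<close> moves \<open>\<theta>\<close> into \<open>T\<close>, where
  it extends, and the extension is pulled back.\<close>

lemma homogeneous_cs_extend:
  assumes T: "homogeneous_cs T" and S: "completely_regular S" "completely_regular S'"
    and f: "f \<in> sgrp_iso S T" and g: "g \<in> sgrp_iso S' T"
    and A: "fg_cs_subsemigroup S A" and B: "fg_cs_subsemigroup S' B"
    and \<theta>: "\<theta> \<in> sgrp_iso (S\<lparr>carrier := A\<rparr>) (S'\<lparr>carrier := B\<rparr>)"
  shows "\<exists>\<phi>\<in>sgrp_iso S S'. \<forall>x\<in>A. \<phi> x = \<theta> x"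
proof -
  \<comment> \<open>\<open>f\<close> is inverted on \<open>A\<close> only, where
    \<open>\<theta>\<close> lives, whereas \<open>g\<close> is inverted on all of \<open>S'\<close>,
    since the extension takes values throughout \<open>T\<close>.\<close>
  define f' where "f' = inv_into A f"
  define g' where "g' = inv_into (carrier S') g"
  have AS: "A \<subseteq> carrier S" using S A by (simp add: fg_cs_subsemigroup_subset)
  have BS: "B \<subseteq> carrier S'" using S B by (simp add: fg_cs_subsemigroup_subset)
  have cA: "is_semigroup (S\<lparr>carrier := A\<rparr>)"
    using A by (simp add: fg_cs_subsemigroup_def completely_simple_def)
  have "f' \<in> sgrp_iso (T\<lparr>carrier := f ` A\<rparr>) (S\<lparr>carrier := A\<rparr>)"
    using sgrp_iso_inv_into[OF cA sgrp_iso_restrict[OF f AS]] by (simp add: f'_def)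
  then have 1: "g \<circ> (\<theta> \<circ> f') \<in> sgrp_iso (T\<lparr>carrier := f ` A\<rparr>) (T\<lparr>carrier := g ` B\<rparr>)"
    by (intro sgrp_iso_compose[OF _ sgrp_iso_restrict[OF g BS]] sgrp_iso_compose[OF _ \<theta>])
  have 2: "g' \<in> sgrp_iso T S'"
    using sgrp_iso_inv_into[OF completely_regular_semigroup[OF S(2)] g] by (simp add: g'_def)
  have "\<exists>\<phi>\<in>sgrp_iso T T. \<forall>x\<in>f ` A. \<phi> x = (g \<circ> (\<theta> \<circ> f')) x"
    using sgrp_iso_fg_cs_subsemigroup[OF S(1) f A] sgrp_iso_fg_cs_subsemigroup[OF S(2) g B]
    by (rule homogeneous_csD[OF T 1])
  then obtain \<phi> where \<phi>: "\<phi> \<in> sgrp_iso T T" "\<And>x. x \<in> A \<Longrightarrow> \<phi> (f x) = g (\<theta> (f' (f x)))"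
    by auto
  have "f' (f x) = x" if "x \<in> A" for x
    using that AS sgrp_isoD(4)[OF f] by (simp add: f'_def inj_on_subset)
  moreover have "g' (g (\<theta> x)) = \<theta> x" if "x \<in> A" for x
    using that BS sgrp_isoD(4)[OF g] sgrp_isoD(2)[OF \<theta>, of x] by (simp add: g'_def subsetD)
  ultimately have "\<forall>x\<in>A. (g' \<circ> \<phi> \<circ> f) x = \<theta> x" using \<phi>(2) by simp
  moreover have "g' \<circ> \<phi> \<circ> f \<in> sgrp_iso S S'"
    by (intro sgrp_iso_compose[OF f] sgrp_iso_compose[OF \<phi>(1) 2])
  ultimately show ?thesis by blast
qed

subsection \<open>Rees matrix semigroups\<close>

abbreviation (input) rees ::
  "('g, 'b) monoid_scheme \<Rightarrow> 'i set \<Rightarrow> 'l set \<Rightarrow> ('l \<Rightarrow> 'i \<Rightarrow> 'g) \<Rightarrow> ('i \<times> 'g \<times> 'l) sgrp" where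
  "rees \<equiv> rees_matrix_semigroup"

text \<open>The base indices are explicit because several are in play at once. Membership of the
  entries is included so that replacing the carrier of \<open>G\<close> by a subgroup asserts that
  the entries lie there.\<close>

definition normalised_at ::
  "('g, 'b) monoid_scheme \<Rightarrow> 'i set \<Rightarrow> 'l set \<Rightarrow> ('l \<Rightarrow> 'i \<Rightarrow> 'g) \<Rightarrow> 'i \<Rightarrow> 'l \<Rightarrow> bool" where
  "normalised_at G I \<Lambda> P i\<^sub>0 l\<^sub>0 \<longleftrightarrow> i\<^sub>0 \<in> I \<and> l\<^sub>0 \<in> \<Lambda> \<and>
     (\<forall>l\<in>\<Lambda>. \<forall>i\<in>I. P l i \<in> carrier G) \<and>
     (\<forall>i\<in>I. P l\<^sub>0 i = \<one>\<^bsub>G\<^esub>) \<and> (\<forall>l\<in>\<Lambda>. P l i\<^sub>0 = \<one>\<^bsub>G\<^esub>)"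

lemma rees_carrier [simp]: "carrier (rees G I \<Lambda> P) = I \<times> carrier G \<times> \<Lambda>"
  by (simp add: rees_matrix_semigroup_def)

lemma rees_prod [simp]:
  "(i, g, l) \<cdot>\<^bsub>rees G I \<Lambda> P\<^esub> (j, h, m) = (i, g \<otimes>\<^bsub>G\<^esub> P l j \<otimes>\<^bsub>G\<^esub> h, m)"
  by (simp add: rees_matrix_semigroup_def)

text \<open>Makes the results on isomorphisms of Rees matrix semigroups applicable to the boxes
  inside one.\<close>

lemma rees_restrict:
  "(rees G I \<Lambda> P)\<lparr>carrier := J \<times> H \<times> M\<rparr> = rees (G\<lparr>carrier := H\<rparr>) J M P"
  by (simp add: rees_matrix_semigroup_def)

locale rees_matrix = group G
  for G :: "('g, 'b) monoid_scheme" (structure) +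
  fixes I :: "'i set" and \<Lambda> :: "'l set" and P :: "'l \<Rightarrow> 'i \<Rightarrow> 'g"
  assumes entry [simp, intro]: "l \<in> \<Lambda> \<Longrightarrow> i \<in> I \<Longrightarrow> P l i \<in> carrier G"
begin

lemma inv_cancel_left:
  assumes "x \<in> carrier G" "y \<in> carrier G"
  shows "x \<otimes> (inv x \<otimes> y) = y" "inv x \<otimes> (x \<otimes> y) = y"
  using assms by (simp_all flip: m_assoc)

lemma rees_semigroup: "is_semigroup (rees G I \<Lambda> P)"
  by (auto simp: is_semigroup_def m_assoc)

lemma rees_idempotent_iff:
  assumes "i \<in> I" "g \<in> carrier G" "l \<in> \<Lambda>"
  shows "g \<otimes> P l i \<otimes> g = g \<longleftrightarrow> g = inv (P l i)"
proof -
  have "g \<otimes> P l i \<otimes> g = g \<longleftrightarrow> g \<otimes> P l i = \<one>" using assms by simp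
  also have "\<dots> \<longleftrightarrow> g = inv (P l i)" using assms by (metis entry inv_equality l_inv)
  finally show ?thesis .
qed

lemma rees_idempotents:
  "idempotents (rees G I \<Lambda> P) = {(i, inv (P l i), l) | i l. i \<in> I \<and> l \<in> \<Lambda>}"
  by (auto simp: idempotents_def rees_idempotent_iff simp del: r_cancel_one r_cancel_one')

lemma rees_inv_aux:
  assumes "i \<in> I" "g \<in> carrier G" "l \<in> \<Lambda>"
  shows "g \<otimes> P l i \<otimes> (inv (P l i) \<otimes> inv g \<otimes> inv (P l i)) = inv (P l i)"
    "inv (P l i) \<otimes> inv g \<otimes> inv (P l i) \<otimes> P l i \<otimes> g = inv (P l i)"
  using assms by (simp_all add: m_assoc inv_cancel_left)

text \<open>The set \<open>{i} \<times> carrier G \<times> {l}\<close> is a group with identity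
  \<open>(i, inv (P l i), l)\<close>; the middle coordinate is found by solving for that
  identity.\<close>

lemma rees_inv:
  assumes "i \<in> I" "g \<in> carrier G" "l \<in> \<Lambda>"
  shows "sgrp_inv (rees G I \<Lambda> P) (i, g, l) = (i, inv (P l i) \<otimes> inv g \<otimes> inv (P l i), l)"
  using assms rees_inv_aux[OF assms]
  by (intro sgrp_inv_eqI rees_semigroup) (auto simp: m_assoc)

lemma rees_completely_regular: "completely_regular (rees G I \<Lambda> P)"
  unfolding completely_regular_def
proof (intro conjI ballI rees_semigroup)
  fix x assume "x \<in> carrier (rees G I \<Lambda> P)"
  then obtain i g l where x: "x = (i, g, l)" "i \<in> I" "g \<in> carrier G" "l \<in> \<Lambda>" by auto
  then show "\<exists>y\<in>carrier (rees G I \<Lambda> P).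
    x \<cdot>\<^bsub>rees G I \<Lambda> P\<^esub> y \<cdot>\<^bsub>rees G I \<Lambda> P\<^esub> x = x \<and>
    y \<cdot>\<^bsub>rees G I \<Lambda> P\<^esub> x \<cdot>\<^bsub>rees G I \<Lambda> P\<^esub> y = y \<and>
    x \<cdot>\<^bsub>rees G I \<Lambda> P\<^esub> y = y \<cdot>\<^bsub>rees G I \<Lambda> P\<^esub> x"
    using rees_inv_aux[OF x(2-4)]
    by (intro bexI[of _ "(i, inv (P l i) \<otimes> inv g \<otimes> inv (P l i), l)"]) (auto simp: m_assoc)
qed

text \<open>Multiplying on both sides carries any element to any other, so there are no proper
  ideals; and \<open>e f = f = f e\<close> forces the outer indices of two idempotents to agree, so
  every idempotent is primitive.\<close>

lemma rees_completely_simple: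
  assumes "I \<noteq> {}" "\<Lambda> \<noteq> {}"
  shows "completely_simple (rees G I \<Lambda> P)"
  unfolding completely_simple_def
proof (intro conjI allI impI rees_semigroup)
  fix J assume J: "sgrp_ideal (rees G I \<Lambda> P) J"
  then obtain i g l where x: "(i, g, l) \<in> J" by (force simp: sgrp_ideal_def)
  then have x': "i \<in> I" "g \<in> carrier G" "l \<in> \<Lambda>" using J by (auto simp: sgrp_ideal_def)
  have "(j, h, m) \<in> J" if "j \<in> I" "h \<in> carrier G" "m \<in> \<Lambda>" for j h m
  proof -
    \<comment> \<open>Solves \<open>?a \<otimes> P l i \<otimes> g \<otimes> P l i = h\<close>, the
      left side being the middle coordinate of the triple product below.\<close>
    let ?a = "h \<otimes> inv (P l i \<otimes> g \<otimes> P l i)"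
    have "(j, ?a, l) \<cdot>\<^bsub>rees G I \<Lambda> P\<^esub> (i, g, l) \<cdot>\<^bsub>rees G I \<Lambda> P\<^esub> (i, \<one>, m) \<in> J"
      using J x x' that by (auto simp: sgrp_ideal_def simp del: rees_prod)
    moreover have "?a \<otimes> P l i \<otimes> g \<otimes> P l i \<otimes> \<one> = h \<otimes> (inv (P l i \<otimes> g \<otimes> P l i) \<otimes> (P l i \<otimes> g \<otimes> P l i))"
      using x' that by (simp add: m_assoc del: l_inv)
    ultimately show ?thesis using x' that by simp
  qed
  then show "J = carrier (rees G I \<Lambda> P)" using J by (auto simp: sgrp_ideal_def)
next
  obtain i l where "i \<in> I" "l \<in> \<Lambda>" using assms by auto
  then show "\<exists>e\<in>idempotents (rees G I \<Lambda> P). \<forall>f\<in>idempotents (rees G I \<Lambda> P).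
      e \<cdot>\<^bsub>rees G I \<Lambda> P\<^esub> f = f \<and> f \<cdot>\<^bsub>rees G I \<Lambda> P\<^esub> e = f \<longrightarrow> f = e"
    by (intro bexI[of _ "(i, inv (P l i), l)"]) (auto simp: rees_idempotents)
qed

section \<open>Finitely generated subsemigroups as boxes\<close>

text \<open>The box is closed because all entries for \<open>J\<close> and \<open>M\<close> lie in
  \<open>generate G Y\<close>. It is finitely generated because of the factorisation \<open>(i, g,
  l) = (i, \<one>, l\<^sub>0) (i\<^sub>0, g, l\<^sub>0) (i\<^sub>0, \<one>, l)\<close>, in which the
  middle factors are generated by those with \<open>g\<close> in \<open>Y\<close>.\<close>

lemma rees_fg_cs_box:
  assumes fin: "finite J" "finite M" "finite Y" and sub: "J \<subseteq> I" "M \<subseteq> \<Lambda>" "Y \<subseteq> carrier G"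
    and norm: "normalised_at (G\<lparr>carrier := generate G Y\<rparr>) J M P i\<^sub>0 l\<^sub>0"
  shows "fg_cs_subsemigroup (rees G I \<Lambda> P) (J \<times> generate G Y \<times> M)"
proof -
  define R where "R = rees G I \<Lambda> P"
  define H where "H = generate G Y"
  have H: "subgroup H G" using generate_is_subgroup sub by (simp add: H_def)
  note Hc = subgroup.m_closed[OF H] subgroup.one_closed[OF H] subgroup.m_inv_closed[OF H]
    subgroup.mem_carrier[OF H]
  note n = norm[folded H_def, unfolded normalised_at_def, simplified]
  have cs: "completely_simple (R\<lparr>carrier := J \<times> H \<times> M\<rparr>)"
    unfolding R_def rees_restrict
    using n by (intro rees_matrix.rees_completely_simple)
      (auto simp: rees_matrix_def rees_matrix_axioms_def subgroup.subgroup_is_group[OF H] is_group)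
  \<comment> \<open>\<open>J\<close> supplies the left factors, \<open>Y\<close> the generators of
    the middle ones and \<open>M\<close> the right factors.\<close>
  define X where "X = J \<times> {\<one>} \<times> {l\<^sub>0} \<union> {i\<^sub>0} \<times> Y \<times> {l\<^sub>0} \<union> {i\<^sub>0} \<times> {\<one>} \<times> M"
  have XR: "X \<subseteq> carrier R" using sub n by (auto simp: X_def R_def)
  have "sgrp_generate R X \<subseteq> J \<times> H \<times> M"
  proof (rule sgrp_generate_subset)
    show "X \<subseteq> J \<times> H \<times> M" using n Hc by (auto simp: X_def H_def intro: generate.incl)
    show "x \<cdot>\<^bsub>R\<^esub> y \<in> J \<times> H \<times> M" if "x \<in> J \<times> H \<times> M" "y \<in> J \<times> H \<times> M" for x y
      using that n Hc by (auto simp: R_def)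
    show "sgrp_inv R x \<in> J \<times> H \<times> M" if x: "x \<in> J \<times> H \<times> M" for x
    proof -
      obtain i g l where x: "x = (i, g, l)" "i \<in> J" "g \<in> H" "l \<in> M" using x by auto
      then have "sgrp_inv R x = (i, inv (P l i) \<otimes> inv g \<otimes> inv (P l i), l)"
        unfolding R_def x(1) using sub Hc by (intro rees_inv) auto
      then show ?thesis using x n Hc by auto
    qed
  qed
  moreover have "J \<times> H \<times> M \<subseteq> sgrp_generate R X"
  proof clarify
    fix i g l assume x: "i \<in> J" "g \<in> H" "l \<in> M"
    have i0: "i\<^sub>0 \<in> I" "l\<^sub>0 \<in> \<Lambda>" using n sub by auto
    have "(i\<^sub>0, g, l\<^sub>0) \<in> sgrp_generate R X"
      using x(2) unfolding H_def
    proof induction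
      case (inv h)
      then have "h \<in> carrier G" using sub by auto
      then have "sgrp_inv R (i\<^sub>0, h, l\<^sub>0) = (i\<^sub>0, inv h, l\<^sub>0)"
        unfolding R_def using i0 n by (subst rees_inv) auto
      then show ?case using inv sgrp_generate.inv[of "(i\<^sub>0, h, l\<^sub>0)" R X] sgrp_generate.incl[of _ X R]
        by (auto simp: X_def)
    next
      case (eng h1 h2)
      then have "h1 \<in> carrier G" "h2 \<in> carrier G" using Hc by (auto simp: H_def)
      then have "(i\<^sub>0, h1, l\<^sub>0) \<cdot>\<^bsub>R\<^esub> (i\<^sub>0, h2, l\<^sub>0) = (i\<^sub>0, h1 \<otimes> h2, l\<^sub>0)"
        using n by (simp add: R_def)
      then show ?case using sgrp_generate.prod[OF eng.IH] by simp
    qed (use n in \<open>auto simp: X_def intro: sgrp_generate.incl\<close>)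
    moreover have "(i, \<one>, l\<^sub>0) \<in> sgrp_generate R X" "(i\<^sub>0, \<one>, l) \<in> sgrp_generate R X"
      using x by (auto simp: X_def intro: sgrp_generate.incl)
    ultimately have "(i, \<one>, l\<^sub>0) \<cdot>\<^bsub>R\<^esub> (i\<^sub>0, g, l\<^sub>0) \<cdot>\<^bsub>R\<^esub> (i\<^sub>0, \<one>, l) \<in> sgrp_generate R X"
      by (intro sgrp_generate.prod)
    then show "(i, g, l) \<in> sgrp_generate R X"
      using x n Hc by (simp add: R_def)
  qed
  ultimately have "J \<times> H \<times> M = sgrp_generate R X" by (rule equalityI[rotated])
  moreover have "finite X" using fin by (simp add: X_def)
  ultimately show ?thesis
    using cs XR unfolding fg_cs_subsemigroup_def R_def H_def by blast
qed

text \<open>Multiplying by the base idempotent on either side replaces an outer index by a base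
  index. Thus \<open>A\<close> contains each coordinate of its elements separately, and can
  recombine them freely.\<close>

lemma rees_fg_cs_is_box:
  assumes norm: "normalised_at G I \<Lambda> P i\<^sub>0 l\<^sub>0"
    and A: "fg_cs_subsemigroup (rees G I \<Lambda> P) A" and e: "(i\<^sub>0, \<one>, l\<^sub>0) \<in> A"
  shows "\<exists>J M H. finite J \<and> finite M \<and> J \<subseteq> I \<and> M \<subseteq> \<Lambda> \<and> fg_subgroup G H \<and>
    normalised_at (G\<lparr>carrier := H\<rparr>) J M P i\<^sub>0 l\<^sub>0 \<and> A = J \<times> H \<times> M"
proof -
  define R where "R = rees G I \<Lambda> P"
  obtain X where X: "finite X" "X \<subseteq> carrier R" and AX: "A = sgrp_generate R X"
    using A by (auto simp: fg_cs_subsemigroup_def R_def)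
  have AR: "A \<subseteq> I \<times> carrier G \<times> \<Lambda>"
    using fg_cs_subsemigroup_subset[OF rees_completely_regular A] by simp
  have prodA: "x \<cdot>\<^bsub>R\<^esub> y \<in> A" if "x \<in> A" "y \<in> A" for x y
    using that unfolding AX by (rule sgrp_generate.prod)
  have invA: "sgrp_inv R x \<in> A" if "x \<in> A" for x
    using that unfolding AX by (rule sgrp_generate.inv)
  note n = norm[unfolded normalised_at_def]
  \<comment> \<open>The base indices are inserted so that the box is normalised by construction; the
    assumption \<open>e\<close> puts the base idempotent in \<open>A\<close> as well.\<close>
  define J where "J = insert i\<^sub>0 (fst ` X)"
  define M where "M = insert l\<^sub>0 ((snd \<circ> snd) ` X)"
  \<comment> \<open>The entries join the group coordinates of the generators because
    \<open>(i\<^sub>0, \<one>, l) (i, \<one>, l\<^sub>0) = (i\<^sub>0, P l i,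
    l\<^sub>0)\<close>.\<close>
  define Y where "Y = (fst \<circ> snd) ` X \<union> (\<lambda>(l, i). P l i) ` (M \<times> J)"
  define H where "H = generate G Y"
  have JM: "J \<subseteq> I" "M \<subseteq> \<Lambda>" using X(2) n by (auto simp: J_def M_def R_def)
  have Y: "Y \<subseteq> carrier G" using X(2) JM by (auto simp: Y_def R_def)
  have H: "subgroup H G" using generate_is_subgroup Y by (simp add: H_def)
  note Hc = subgroup.m_closed[OF H] subgroup.one_closed[OF H] subgroup.m_inv_closed[OF H]
    subgroup.mem_carrier[OF H]
  have PH: "P l i \<in> H" if "l \<in> M" "i \<in> J" for l i
    using that unfolding H_def by (intro generate.incl) (auto simp: Y_def)
  have AJ: "A \<subseteq> J \<times> H \<times> M"
    unfolding AX
  proof (rule sgrp_generate_subset)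
    show "X \<subseteq> J \<times> H \<times> M"
    proof
      fix x assume "x \<in> X"
      then have "fst x \<in> J" "fst (snd x) \<in> H" "snd (snd x) \<in> M"
        by (auto simp: J_def M_def H_def Y_def intro: generate.incl)
      then show "x \<in> J \<times> H \<times> M" by (cases x) auto
    qed
    show "x \<cdot>\<^bsub>R\<^esub> y \<in> J \<times> H \<times> M" if "x \<in> J \<times> H \<times> M" "y \<in> J \<times> H \<times> M" for x y
      using that PH Hc by (auto simp: R_def)
    show "sgrp_inv R x \<in> J \<times> H \<times> M" if x: "x \<in> J \<times> H \<times> M" for x
    proof -
      obtain i g l where x: "x = (i, g, l)" "i \<in> J" "g \<in> H" "l \<in> M" using x by auto
      then have "sgrp_inv R x = (i, inv (P l i) \<otimes> inv g \<otimes> inv (P l i), l)"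
        unfolding R_def x(1) using JM Hc by (intro rees_inv) auto
      then show ?thesis using x PH Hc by auto
    qed
  qed
  have coords: "(i, \<one>, l\<^sub>0) \<in> A" "(i\<^sub>0, \<one>, l) \<in> A" "(i\<^sub>0, g, l\<^sub>0) \<in> A" if x: "(i, g, l) \<in> A" for i g l
  proof -
    have x': "i \<in> I" "g \<in> carrier G" "l \<in> \<Lambda>" using x AR by auto
    have il: "(i, g, l\<^sub>0) \<in> A" "(i\<^sub>0, g, l) \<in> A"
      using prodA[OF x e] prodA[OF e x] x' n by (simp_all add: R_def)
    show 3: "(i\<^sub>0, g, l\<^sub>0) \<in> A" using prodA[OF e il(1)] x' n by (simp add: R_def)
    \<comment> \<open>Inverting in the maximal subgroup of the base idempotent gives the element
      that strips \<open>g\<close> off the two elements in \<open>il\<close>.\<close>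
    have "(i\<^sub>0, inv g, l\<^sub>0) \<in> A" using invA[OF 3] x' n by (simp add: R_def rees_inv)
    then show "(i, \<one>, l\<^sub>0) \<in> A" "(i\<^sub>0, \<one>, l) \<in> A"
      using prodA[OF il(1), of "(i\<^sub>0, inv g, l\<^sub>0)"] prodA[OF _ il(2), of "(i\<^sub>0, inv g, l\<^sub>0)"] x' n
      by (simp_all add: R_def)
  qed
  have coordsX: "(i, \<one>, l\<^sub>0) \<in> A" "(i\<^sub>0, \<one>, l) \<in> A" "(i\<^sub>0, g, l\<^sub>0) \<in> A" if "(i, g, l) \<in> X" for i g l
    using coords[of i g l] that by (auto simp: AX intro: sgrp_generate.incl)
  have iA: "(i, \<one>, l\<^sub>0) \<in> A" if "i \<in> J" for i
    using that coordsX e by (force simp: J_def)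
  have lA: "(i\<^sub>0, \<one>, l) \<in> A" if "l \<in> M" for l
    using that coordsX e by (force simp: M_def)
  have YA: "(i\<^sub>0, g, l\<^sub>0) \<in> A" if g: "g \<in> Y" for g
  proof -
    consider "g \<in> (fst \<circ> snd) ` X" | "g \<in> (\<lambda>(l, i). P l i) ` (M \<times> J)"
      using g unfolding Y_def by blast
    then show ?thesis
    proof cases
      case 2
      then obtain l i where "l \<in> M" "i \<in> J" "g = P l i" by auto
      then show ?thesis using prodA[OF lA iA, of l i] JM by (auto simp: R_def subset_iff)
    qed (use coordsX in force)
  qed
  have HA: "(i\<^sub>0, g, l\<^sub>0) \<in> A" if "g \<in> H" for g
    using that unfolding H_def
  proof induction
    case (inv h)
    then show ?case using Y invA[OF YA[of h]] n by (auto simp: R_def rees_inv subset_iff)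
  next
    case (eng h1 h2)
    then have "h1 \<in> carrier G" "h2 \<in> carrier G" using Hc by (auto simp: H_def)
    then show ?case using prodA[OF eng.IH] n by (simp add: R_def)
  qed (use e YA in auto)
  have "J \<times> H \<times> M \<subseteq> A"
  proof clarify
    fix i g l assume x: "i \<in> J" "g \<in> H" "l \<in> M"
    then have "(i, \<one>, l\<^sub>0) \<cdot>\<^bsub>R\<^esub> (i\<^sub>0, g, l\<^sub>0) \<cdot>\<^bsub>R\<^esub> (i\<^sub>0, \<one>, l) \<in> A"
      using prodA iA HA lA by blast
    then show "(i, g, l) \<in> A" using x n Hc by (simp add: R_def)
  qed
  then have "A = J \<times> H \<times> M" using AJ by auto
  moreover have "finite J" "finite M" "finite Y" using X by (auto simp: J_def M_def Y_def)
  moreover have "normalised_at (G\<lparr>carrier := H\<rparr>) J M P i\<^sub>0 l\<^sub>0"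
    using n JM PH by (auto simp: normalised_at_def J_def M_def)
  ultimately show ?thesis
    using JM Y unfolding fg_subgroup_def H_def by blast
qed

end

subsection \<open>Isomorphisms of normalised Rees matrix semigroups\<close>

lemma rees_iso_intro:
  assumes \<psi>: "bij_betw \<psi> I J" and \<alpha>: "\<alpha> \<in> iso G H" and \<chi>: "bij_betw \<chi> \<Lambda> M"
    and G: "group G" and P: "\<And>l i. l \<in> \<Lambda> \<Longrightarrow> i \<in> I \<Longrightarrow> P l i \<in> carrier G"
    and PQ: "\<And>l i. l \<in> \<Lambda> \<Longrightarrow> i \<in> I \<Longrightarrow> \<alpha> (P l i) = Q (\<chi> l) (\<psi> i)"
  shows "(\<lambda>(i, g, l). (\<psi> i, \<alpha> g, \<chi> l)) \<in> sgrp_iso (rees G I \<Lambda> P) (rees H J M Q)"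
proof -
  interpret group G by fact
  have "(\<lambda>(i, g, l). (\<psi> i, \<alpha> g, \<chi> l)) = map_prod \<psi> (map_prod \<alpha> \<chi>)" by (auto simp: fun_eq_iff)
  moreover have "bij_betw (map_prod \<psi> (map_prod \<alpha> \<chi>)) (I \<times> carrier G \<times> \<Lambda>) (J \<times> carrier H \<times> M)"
    using \<psi> \<alpha> \<chi> by (auto simp: iso_def intro!: bij_betw_map_prod)
  ultimately show ?thesis
    using \<alpha> P PQ by (auto simp: sgrp_iso_def iso_def hom_mult)
qed

text \<open>In general an isomorphism twists the group coordinate by factors depending on the outer
  indices. Matching the base idempotents makes these factors trivial, since products with a base
  idempotent pin down the images of \<open>(i, \<one>, l\<^sub>0)\<close>,
  \<open>(i\<^sub>0, g, l\<^sub>0)\<close> and \<open>(i\<^sub>0, \<one>, l)\<close>, whose products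
  give every element.\<close>

lemma rees_iso_decompose:
  assumes G: "group G" and H: "group H"
    and P: "normalised_at G I \<Lambda> P i\<^sub>0 l\<^sub>0" and Q: "normalised_at H J M Q j\<^sub>0 m\<^sub>0"
    and \<phi>: "\<phi> \<in> sgrp_iso (rees G I \<Lambda> P) (rees H J M Q)"
    and e: "\<phi> (i\<^sub>0, \<one>\<^bsub>G\<^esub>, l\<^sub>0) = (j\<^sub>0, \<one>\<^bsub>H\<^esub>, m\<^sub>0)"
  obtains \<psi> \<alpha> \<chi> where "bij_betw \<psi> I J" "\<alpha> \<in> iso G H" "bij_betw \<chi> \<Lambda> M"
    "\<And>i g l. i \<in> I \<Longrightarrow> g \<in> carrier G \<Longrightarrow> l \<in> \<Lambda> \<Longrightarrow> \<phi> (i, g, l) = (\<psi> i, \<alpha> g, \<chi> l)"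
    "\<And>l i. l \<in> \<Lambda> \<Longrightarrow> i \<in> I \<Longrightarrow> \<alpha> (P l i) = Q (\<chi> l) (\<psi> i)"
    "\<psi> i\<^sub>0 = j\<^sub>0" "\<chi> l\<^sub>0 = m\<^sub>0"
proof -
  interpret G: group G by fact
  interpret H: group H by fact
  note P' = P[unfolded normalised_at_def] and Q' = Q[unfolded normalised_at_def]
  note \<phi>' = sgrp_isoD[OF \<phi>, simplified]
  have mult: "\<phi> (i, g \<otimes>\<^bsub>G\<^esub> P l i' \<otimes>\<^bsub>G\<^esub> g', l') = \<phi> (i, g, l) \<cdot>\<^bsub>rees H J M Q\<^esub> \<phi> (i', g', l')"
    if "i \<in> I" "g \<in> carrier G" "l \<in> \<Lambda>" "i' \<in> I" "g' \<in> carrier G" "l' \<in> \<Lambda>" for i g l i' g' l'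
    using sgrp_isoD(3)[OF \<phi>, of "(i, g, l)" "(i', g', l')"] that by simp
  define \<psi> where "\<psi> i = fst (\<phi> (i, \<one>\<^bsub>G\<^esub>, l\<^sub>0))" for i
  define \<alpha> where "\<alpha> g = fst (snd (\<phi> (i\<^sub>0, g, l\<^sub>0)))" for g
  define \<chi> where "\<chi> l = snd (snd (\<phi> (i\<^sub>0, \<one>\<^bsub>G\<^esub>, l)))" for l
  have col: "\<phi> (i, \<one>\<^bsub>G\<^esub>, l\<^sub>0) = (\<psi> i, \<one>\<^bsub>H\<^esub>, m\<^sub>0) \<and> \<psi> i \<in> J" if "i \<in> I" for i
  proof -
    obtain j h m where x: "\<phi> (i, \<one>\<^bsub>G\<^esub>, l\<^sub>0) = (j, h, m)" "j \<in> J" "h \<in> carrier H" "m \<in> M"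
      using \<phi>'(2)[of "(i, \<one>\<^bsub>G\<^esub>, l\<^sub>0)"] \<open>i \<in> I\<close> P' by auto
    \<comment> \<open>Right multiplication by the base idempotent fixes the element, which gives
      \<open>m = m\<^sub>0\<close>; idempotency then gives \<open>h = \<one>\<close>.\<close>
    have "(j, h, m) = (j, h \<otimes>\<^bsub>H\<^esub> Q m j\<^sub>0 \<otimes>\<^bsub>H\<^esub> \<one>\<^bsub>H\<^esub>, m\<^sub>0)"
      using mult[of i "\<one>\<^bsub>G\<^esub>" l\<^sub>0 i\<^sub>0 "\<one>\<^bsub>G\<^esub>" l\<^sub>0] x e Q' \<open>i \<in> I\<close> P' by simp
    moreover have "(j, h, m) = (j, h \<otimes>\<^bsub>H\<^esub> Q m j \<otimes>\<^bsub>H\<^esub> h, m)"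
      using mult[of i "\<one>\<^bsub>G\<^esub>" l\<^sub>0 i "\<one>\<^bsub>G\<^esub>" l\<^sub>0] x Q' \<open>i \<in> I\<close> P' by simp
    ultimately show ?thesis using x Q' by (simp add: \<psi>_def)
  qed
  have row: "\<phi> (i\<^sub>0, \<one>\<^bsub>G\<^esub>, l) = (j\<^sub>0, \<one>\<^bsub>H\<^esub>, \<chi> l) \<and> \<chi> l \<in> M" if "l \<in> \<Lambda>" for l
  proof -
    obtain j h m where x: "\<phi> (i\<^sub>0, \<one>\<^bsub>G\<^esub>, l) = (j, h, m)" "j \<in> J" "h \<in> carrier H" "m \<in> M"
      using \<phi>'(2)[of "(i\<^sub>0, \<one>\<^bsub>G\<^esub>, l)"] \<open>l \<in> \<Lambda>\<close> P' by auto
    have "(j, h, m) = (j\<^sub>0, \<one>\<^bsub>H\<^esub> \<otimes>\<^bsub>H\<^esub> Q m\<^sub>0 j \<otimes>\<^bsub>H\<^esub> h, m)"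
      using mult[of i\<^sub>0 "\<one>\<^bsub>G\<^esub>" l\<^sub>0 i\<^sub>0 "\<one>\<^bsub>G\<^esub>" l] x e Q' \<open>l \<in> \<Lambda>\<close> P' by simp
    moreover have "(j, h, m) = (j, h \<otimes>\<^bsub>H\<^esub> Q m j \<otimes>\<^bsub>H\<^esub> h, m)"
      using mult[of i\<^sub>0 "\<one>\<^bsub>G\<^esub>" l i\<^sub>0 "\<one>\<^bsub>G\<^esub>" l] x Q' \<open>l \<in> \<Lambda>\<close> P' by simp
    ultimately show ?thesis using x Q' by (simp add: \<chi>_def)
  qed
  have grp: "\<phi> (i\<^sub>0, g, l\<^sub>0) = (j\<^sub>0, \<alpha> g, m\<^sub>0) \<and> \<alpha> g \<in> carrier H" if "g \<in> carrier G" for g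
  proof -
    obtain j h m where x: "\<phi> (i\<^sub>0, g, l\<^sub>0) = (j, h, m)" "j \<in> J" "h \<in> carrier H" "m \<in> M"
      using \<phi>'(2)[of "(i\<^sub>0, g, l\<^sub>0)"] \<open>g \<in> carrier G\<close> P' by auto
    have "(j, h, m) = (j\<^sub>0, \<one>\<^bsub>H\<^esub> \<otimes>\<^bsub>H\<^esub> Q m\<^sub>0 j \<otimes>\<^bsub>H\<^esub> h, m)"
      using mult[of i\<^sub>0 "\<one>\<^bsub>G\<^esub>" l\<^sub>0 i\<^sub>0 g l\<^sub>0] x e Q' \<open>g \<in> carrier G\<close> P' by simp
    moreover have "(j, h, m) = (j, h \<otimes>\<^bsub>H\<^esub> Q m j\<^sub>0 \<otimes>\<^bsub>H\<^esub> \<one>\<^bsub>H\<^esub>, m\<^sub>0)"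
      using mult[of i\<^sub>0 g l\<^sub>0 i\<^sub>0 "\<one>\<^bsub>G\<^esub>" l\<^sub>0] x e Q' \<open>g \<in> carrier G\<close> P' by simp
    ultimately show ?thesis using x Q' by (simp add: \<alpha>_def)
  qed
  have form: "\<phi> (i, g, l) = (\<psi> i, \<alpha> g, \<chi> l)" if "i \<in> I" "g \<in> carrier G" "l \<in> \<Lambda>" for i g l
  proof -
    have "\<phi> (i, g, l) = \<phi> (i, g, l\<^sub>0) \<cdot>\<^bsub>rees H J M Q\<^esub> \<phi> (i\<^sub>0, \<one>\<^bsub>G\<^esub>, l)"
      using mult[of i g l\<^sub>0 i\<^sub>0 "\<one>\<^bsub>G\<^esub>" l] that P' by simp
    also have "\<phi> (i, g, l\<^sub>0) = \<phi> (i, \<one>\<^bsub>G\<^esub>, l\<^sub>0) \<cdot>\<^bsub>rees H J M Q\<^esub> \<phi> (i\<^sub>0, g, l\<^sub>0)"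
      using mult[of i "\<one>\<^bsub>G\<^esub>" l\<^sub>0 i\<^sub>0 g l\<^sub>0] that P' by simp
    finally show ?thesis using that col row grp Q' by simp
  qed
  \<comment> \<open>The entry is the middle coordinate of
    \<open>(i\<^sub>0, \<one>, l) (i, \<one>, l\<^sub>0)\<close>.\<close>
  have entries: "\<alpha> (P l i) = Q (\<chi> l) (\<psi> i)" if "l \<in> \<Lambda>" "i \<in> I" for l i
    using mult[of i\<^sub>0 "\<one>\<^bsub>G\<^esub>" l i "\<one>\<^bsub>G\<^esub>" l\<^sub>0] that col row grp P' Q' by simp
  have base: "\<psi> i\<^sub>0 = j\<^sub>0" "\<chi> l\<^sub>0 = m\<^sub>0" using e by (simp_all add: \<psi>_def \<chi>_def)
  \<comment> \<open>Stated for the three coordinates jointly, as is \<open>inj\<close>; fixing two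
    of them at base values yields the three bijections.\<close>
  have onto: "\<exists>i\<in>I. \<exists>g\<in>carrier G. \<exists>l\<in>\<Lambda>. j = \<psi> i \<and> h = \<alpha> g \<and> m = \<chi> l"
    if "j \<in> J" "h \<in> carrier H" "m \<in> M" for j h m
  proof -
    have "(j, h, m) \<in> \<phi> ` (I \<times> carrier G \<times> \<Lambda>)" using that \<phi>'(5) by simp
    then show ?thesis using form by auto
  qed
  have inj: "i = i' \<and> g = g' \<and> l = l'"
    if "i \<in> I" "i' \<in> I" "g \<in> carrier G" "g' \<in> carrier G" "l \<in> \<Lambda>" "l' \<in> \<Lambda>"
      "\<psi> i = \<psi> i'" "\<alpha> g = \<alpha> g'" "\<chi> l = \<chi> l'" for i i' g g' l l'
    using inj_onD[OF \<phi>'(4), of "(i, g, l)" "(i', g', l')"] that form by simp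
  show ?thesis
  proof
    show "bij_betw \<psi> I J"
      unfolding bij_betw_def inj_on_def
      using inj[of _ _ "\<one>\<^bsub>G\<^esub>" "\<one>\<^bsub>G\<^esub>" l\<^sub>0 l\<^sub>0] onto[of _ "\<one>\<^bsub>H\<^esub>" m\<^sub>0] col P' Q' by fastforce
    show "bij_betw \<chi> \<Lambda> M"
      unfolding bij_betw_def inj_on_def
      using inj[of i\<^sub>0 i\<^sub>0 "\<one>\<^bsub>G\<^esub>" "\<one>\<^bsub>G\<^esub>"] onto[of j\<^sub>0 "\<one>\<^bsub>H\<^esub>"] row P' Q' by fastforce
    have "bij_betw \<alpha> (carrier G) (carrier H)"
      unfolding bij_betw_def inj_on_def
      using inj[of i\<^sub>0 i\<^sub>0 _ _ l\<^sub>0 l\<^sub>0] onto[of j\<^sub>0 _ m\<^sub>0] grp P' Q' by fastforce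
    moreover have "\<alpha> (g \<otimes>\<^bsub>G\<^esub> h) = \<alpha> g \<otimes>\<^bsub>H\<^esub> \<alpha> h" if "g \<in> carrier G" "h \<in> carrier G" for g h
      using mult[of i\<^sub>0 g l\<^sub>0 i\<^sub>0 h l\<^sub>0] that grp P' Q' by simp
    ultimately show "\<alpha> \<in> iso G H" using grp by (auto simp: iso_def hom_def)
  qed (fact form entries base)+
qed

section \<open>Renormalising the matrix at an arbitrary pair of indices\<close>

text \<open>The usual normalisation of a sandwich matrix: row \<open>l\<close> is scaled on the left
  by \<open>inv (P l i\<^sub>0)\<close> and column \<open>i\<close> on the right by
  \<open>inv (P l\<^sub>0 i) \<otimes> P l\<^sub>0 i\<^sub>0\<close>. The last factor makes the row
  and the column through the base trivial.\<close>

definition renormalise ::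
  "('g, 'b) monoid_scheme \<Rightarrow> ('l \<Rightarrow> 'i \<Rightarrow> 'g) \<Rightarrow> 'i \<Rightarrow> 'l \<Rightarrow> 'l \<Rightarrow> 'i \<Rightarrow> 'g" where
  "renormalise G P i\<^sub>0 l\<^sub>0 l i =
     inv\<^bsub>G\<^esub> (P l i\<^sub>0) \<otimes>\<^bsub>G\<^esub> P l i \<otimes>\<^bsub>G\<^esub> inv\<^bsub>G\<^esub> (P l\<^sub>0 i) \<otimes>\<^bsub>G\<^esub> P l\<^sub>0 i\<^sub>0"

text \<open>The matching change of the group coordinate, directed from the renormalised semigroup to
  the original one.\<close>

definition renormalise_map ::
  "('g, 'b) monoid_scheme \<Rightarrow> ('l \<Rightarrow> 'i \<Rightarrow> 'g) \<Rightarrow> 'i \<Rightarrow> 'l \<Rightarrow> 'i \<times> 'g \<times> 'l \<Rightarrow> 'i \<times> 'g \<times> 'l" where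
  "renormalise_map G P i\<^sub>0 l\<^sub>0 = (\<lambda>(i, g, l).
     (i, inv\<^bsub>G\<^esub> (P l\<^sub>0 i) \<otimes>\<^bsub>G\<^esub> P l\<^sub>0 i\<^sub>0 \<otimes>\<^bsub>G\<^esub> g \<otimes>\<^bsub>G\<^esub> inv\<^bsub>G\<^esub> (P l i\<^sub>0), l))"

context rees_matrix
begin

lemma inv_cancel_right:
  assumes "x \<in> carrier G" "y \<in> carrier G"
  shows "y \<otimes> inv x \<otimes> x = y" "y \<otimes> x \<otimes> inv x = y"
  using assms by (simp_all add: m_assoc)

text \<open>Renormalised entries are words in the old ones, so they stay in every subgroup
  \<open>N\<close> containing those. This allows one renormalisation to serve both the whole group
  and the subgroup of entries.\<close>

lemma renormalise_normalised_at:
  assumes "i\<^sub>0 \<in> I" "l\<^sub>0 \<in> \<Lambda>" and N: "subgroup N G" "\<And>l i. l \<in> \<Lambda> \<Longrightarrow> i \<in> I \<Longrightarrow> P l i \<in> N"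
  shows "normalised_at (G\<lparr>carrier := N\<rparr>) I \<Lambda> (renormalise G P i\<^sub>0 l\<^sub>0) i\<^sub>0 l\<^sub>0"
  using assms subgroup.m_closed[OF N(1)] subgroup.m_inv_closed[OF N(1)]
  by (auto simp: normalised_at_def renormalise_def inv_cancel_right)

lemma renormalise_map_iso:
  assumes i: "i\<^sub>0 \<in> I" "l\<^sub>0 \<in> \<Lambda>" and N: "subgroup N G" "\<And>l i. l \<in> \<Lambda> \<Longrightarrow> i \<in> I \<Longrightarrow> P l i \<in> N"
  shows "renormalise_map G P i\<^sub>0 l\<^sub>0 \<in> sgrp_iso
    (rees (G\<lparr>carrier := N\<rparr>) I \<Lambda> (renormalise G P i\<^sub>0 l\<^sub>0)) (rees (G\<lparr>carrier := N\<rparr>) I \<Lambda> P)"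
proof -
  note Nc = subgroup.m_closed[OF N(1)] subgroup.m_inv_closed[OF N(1)] subgroup.mem_carrier[OF N(1)] N(2)
  \<comment> \<open>Obtained by solving \<open>renormalise_map\<close> for the group
    coordinate.\<close>
  let ?inv = "\<lambda>(i, g, l). (i, inv (P l\<^sub>0 i\<^sub>0) \<otimes> P l\<^sub>0 i \<otimes> g \<otimes> P l i\<^sub>0, l)"
  have "bij_betw (renormalise_map G P i\<^sub>0 l\<^sub>0) (I \<times> N \<times> \<Lambda>) (I \<times> N \<times> \<Lambda>)"
    using i Nc
    by (intro bij_betw_byWitness[where f' = ?inv])
      (auto simp: renormalise_map_def m_assoc inv_cancel_left)
  moreover have "renormalise_map G P i\<^sub>0 l\<^sub>0 (x \<cdot>\<^bsub>rees (G\<lparr>carrier := N\<rparr>) I \<Lambda> (renormalise G P i\<^sub>0 l\<^sub>0)\<^esub> y) =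
      renormalise_map G P i\<^sub>0 l\<^sub>0 x \<cdot>\<^bsub>rees (G\<lparr>carrier := N\<rparr>) I \<Lambda> P\<^esub> renormalise_map G P i\<^sub>0 l\<^sub>0 y"
    if "x \<in> I \<times> N \<times> \<Lambda>" "y \<in> I \<times> N \<times> \<Lambda>" for x y
    using that i Nc
    by (auto simp: renormalise_map_def renormalise_def m_assoc inv_cancel_left)
  ultimately show ?thesis by (auto simp: sgrp_iso_def)
qed

lemma renormalise_map_one:
  assumes "i\<^sub>0 \<in> I" "l\<^sub>0 \<in> \<Lambda>"
  shows "renormalise_map G P i\<^sub>0 l\<^sub>0 (i\<^sub>0, \<one>, l\<^sub>0) = (i\<^sub>0, inv (P l\<^sub>0 i\<^sub>0), l\<^sub>0)"
  using assms by (simp add: renormalise_map_def)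

end

subsection \<open>Back-and-forth\<close>

text \<open>The bookkeeping of back-and-forth, with states satisfying \<open>R\<close>, an order
  \<open>rel\<close> and a countable set \<open>T\<close> of tasks: the \<open>n\<close>-th step
  performs the \<open>n\<close>-th task of an enumeration.\<close>

lemma increasing_chain:
  assumes c: "countable T" and s0: "R s\<^sub>0" and refl: "\<And>s. rel s s"
    and trans: "\<And>s t u. rel s t \<Longrightarrow> rel t u \<Longrightarrow> rel s u"
    and step: "\<And>s t. R s \<Longrightarrow> t \<in> T \<Longrightarrow> \<exists>s'. R s' \<and> rel s s' \<and> D t s'"
  shows "\<exists>s :: nat \<Rightarrow> 's. s 0 = s\<^sub>0 \<and> (\<forall>n. R (s n)) \<and> (\<forall>m n. m \<le> n \<longrightarrow> rel (s m) (s n)) \<and>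
    (\<forall>t\<in>T. \<exists>n. D t (s n))"
proof (cases "T = {}")
  case True
  then show ?thesis using s0 refl by (intro exI[of _ "\<lambda>_. s\<^sub>0"]) auto
next
  case False
  have "\<exists>s. \<forall>n. (R (s n) \<and> (n = 0 \<longrightarrow> s n = s\<^sub>0)) \<and>
      (rel (s n) (s (Suc n)) \<and> D (from_nat_into T n) (s (Suc n)))"
    using s0 step from_nat_into[OF False]
    by (intro dependent_nat_choice) auto
  then obtain s where s: "\<And>n. R (s n)" "s 0 = s\<^sub>0" "\<And>n. rel (s n) (s (Suc n))"
    "\<And>n. D (from_nat_into T n) (s (Suc n))" by metis
  have "rel (s m) (s n)" if "m \<le> n" for m n
    using that by (induction n rule: dec_induct) (use refl trans s(3) in blast)+
  moreover have "\<exists>n. D t (s n)" if "t \<in> T" for t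
    using s(4)[of "to_nat_on T t"] from_nat_into_to_nat_on[OF c that] by auto
  ultimately show ?thesis using s by blast
qed

section \<open>Partial bijections\<close>

text \<open>Kept as a relation so that converses and unions of chains can be taken directly.\<close>

definition partial_bij :: "('a \<times> 'b) set \<Rightarrow> 'a set \<Rightarrow> 'b set \<Rightarrow> bool" where
  "partial_bij F A B \<longleftrightarrow> F \<subseteq> A \<times> B \<and> single_valued F \<and> single_valued (F\<inverse>)"

lemma partial_bij_total:
  assumes F: "partial_bij F A B" and "A \<subseteq> Domain F" "B \<subseteq> Range F"
  obtains f where "bij_betw f A B" "\<And>a b. (a, b) \<in> F \<longleftrightarrow> a \<in> A \<and> b = f a"
proof -
  define f where "f a = (SOME b. (a, b) \<in> F)" for a
  have f: "(a, f a) \<in> F" if "a \<in> A" for a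
    using that assms(2) unfolding f_def by (metis DomainE someI subsetD)
  have iff: "(a, b) \<in> F \<longleftrightarrow> a \<in> A \<and> b = f a" for a b
    using f F by (auto simp: partial_bij_def dest: single_valuedD)
  have "f ` A = B"
    using iff F assms(3) by (fastforce simp: partial_bij_def)
  moreover have "inj_on f A"
    using f F by (intro inj_onI) (metis converseI partial_bij_def single_valuedD)
  ultimately show ?thesis using that iff by (auto simp: bij_betw_def)
qed

lemma partial_bij_graph:
  assumes "bij_betw f A B"
  shows "partial_bij ((\<lambda>a. (a, f a)) ` A) A B"
  using assms by (auto simp: partial_bij_def bij_betw_def single_valued_def inj_on_def)

lemma partial_bij_subset: "partial_bij F A B \<Longrightarrow> F' \<subseteq> F \<Longrightarrow> partial_bij F' A B"
  unfolding partial_bij_def single_valued_def by (simp add: subset_iff) blast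

lemma partial_bij_converse: "partial_bij F A B \<Longrightarrow> partial_bij (F\<inverse>) B A"
  by (auto simp: partial_bij_def)

text \<open>Two pairs of the union lie together in the later of their two stages, where
  single-valuedness is known.\<close>

lemma partial_bij_Union:
  assumes "\<And>n :: nat. partial_bij (F n) A B" "\<And>m n. m \<le> n \<Longrightarrow> F m \<subseteq> F n"
  shows "partial_bij (\<Union>n. F n) A B"
proof -
  have *: "\<exists>k. x \<in> F k \<and> y \<in> F k" if "x \<in> F m" "y \<in> F n" for x y m n
    using that assms(2)[of m "max m n"] assms(2)[of n "max m n"] by auto
  show ?thesis
    unfolding partial_bij_def
  proof (intro conjI)
    show "(\<Union>n. F n) \<subseteq> A \<times> B" using assms(1) by (auto simp: partial_bij_def)
    show "single_valued (\<Union>n. F n)"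
      using * assms(1) unfolding partial_bij_def single_valued_def by (metis UN_iff)
    show "single_valued ((\<Union>n. F n)\<inverse>)"
      using * assms(1) unfolding partial_bij_def single_valued_def by (metis UN_iff converse_iff)
  qed
qed

section \<open>Finite partial matches of two matrices\<close>

text \<open>A state of the back-and-forth. The group map \<open>\<beta>\<close> is fixed while the
  finite index relations grow; keeping the base pairs \<open>p\<close> and \<open>q\<close> in them
  keeps the boxes that they span normalised.\<close>

definition partial_match ::
  "('g \<Rightarrow> 'g) \<Rightarrow> ('l \<Rightarrow> 'i \<Rightarrow> 'g) \<Rightarrow> ('l \<Rightarrow> 'i \<Rightarrow> 'g) \<Rightarrow> 'i set \<Rightarrow> 'l set \<Rightarrow> 'i \<times> 'i \<Rightarrow> 'l \<times> 'l \<Rightarrow>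
    ('i \<times> 'i) set \<Rightarrow> ('l \<times> 'l) set \<Rightarrow> bool" where
  "partial_match \<beta> Q Q' I \<Lambda> p q F K \<longleftrightarrow> finite F \<and> finite K \<and> partial_bij F I I \<and> partial_bij K \<Lambda> \<Lambda> \<and>
     p \<in> F \<and> q \<in> K \<and> (\<forall>i j l m. (i, j) \<in> F \<longrightarrow> (l, m) \<in> K \<longrightarrow> \<beta> (Q l i) = Q' m j)"

lemma group_iso_image_generate:
  assumes "group G" "group H" "\<beta> \<in> iso G H" "Y \<subseteq> carrier G"
  shows "\<beta> ` generate G Y = generate H (\<beta> ` Y)"
    "\<beta> \<in> iso (G\<lparr>carrier := generate G Y\<rparr>) (H\<lparr>carrier := \<beta> ` generate G Y\<rparr>)"
proof -
  interpret group_hom G H \<beta>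
    using assms by (auto simp: group_hom_def group_hom_axioms_def iso_def)
  show "\<beta> ` generate G Y = generate H (\<beta> ` Y)" using generate_img assms(4) by simp
  have sub: "g \<in> carrier G" if "g \<in> generate G Y" for g
    using that G.generate_in_carrier assms(4) by blast
  show "\<beta> \<in> iso (G\<lparr>carrier := generate G Y\<rparr>) (H\<lparr>carrier := \<beta> ` generate G Y\<rparr>)"
    using assms(3) sub by (auto simp: iso_def hom_def bij_betw_def inj_on_def)
qed

text \<open>The forth step. \<open>F\<close>, \<open>K\<close> and \<open>\<beta>\<close> give an
  isomorphism of boxes, which extends to \<open>\<phi>\<close> by homogeneity of \<open>T\<close>.
  The group part \<open>\<alpha>\<close> of \<open>\<phi>\<close> may differ from
  \<open>\<beta>\<close>, but they agree on \<open>H\<close>, which contains the entries for old and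
  new indices; so the images of \<open>i\<close> and \<open>l\<close> under \<open>\<phi>\<close>
  fit \<open>\<beta>\<close>.\<close>

lemma partial_match_extend:
  fixes M :: "('g, 'b) monoid_scheme"
  assumes M: "group M" and Q: "normalised_at M I \<Lambda> Q i\<^sub>0 l\<^sub>0" and Q': "normalised_at M I \<Lambda> Q' j\<^sub>0 m\<^sub>0"
    and T: "homogeneous_cs T" and f: "f \<in> sgrp_iso (rees M I \<Lambda> Q) T" "g \<in> sgrp_iso (rees M I \<Lambda> Q') T"
    and \<beta>: "\<beta> \<in> iso M M"
    and FK: "partial_match \<beta> Q Q' I \<Lambda> (i\<^sub>0, j\<^sub>0) (l\<^sub>0, m\<^sub>0) F K" and il: "i \<in> I" "l \<in> \<Lambda>"
  shows "\<exists>F' K'. partial_match \<beta> Q Q' I \<Lambda> (i\<^sub>0, j\<^sub>0) (l\<^sub>0, m\<^sub>0) F' K' \<and> F \<subseteq> F' \<and> K \<subseteq> K' \<and>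
    i \<in> Domain F' \<and> l \<in> Domain K'"
proof -
  interpret M: group M by fact
  note q = Q[unfolded normalised_at_def] and q' = Q'[unfolded normalised_at_def]
  note fk = FK[unfolded partial_match_def]
  interpret Q: rees_matrix M I \<Lambda> Q using q by unfold_locales auto
  interpret Q': rees_matrix M I \<Lambda> Q' using q' by unfold_locales auto
  have "partial_bij F (Domain F) (Range F)" using fk by (auto simp: partial_bij_def)
  then obtain u where u: "bij_betw u (Domain F) (Range F)"
    and Fu: "\<And>a b. (a, b) \<in> F \<longleftrightarrow> a \<in> Domain F \<and> b = u a"
    by (rule partial_bij_total) auto
  have "partial_bij K (Domain K) (Range K)" using fk by (auto simp: partial_bij_def)
  then obtain v where v: "bij_betw v (Domain K) (Range K)"
    and Kv: "\<And>a b. (a, b) \<in> K \<longleftrightarrow> a \<in> Domain K \<and> b = v a"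
    by (rule partial_bij_total) auto
  have dom: "Domain F \<subseteq> I" "Range F \<subseteq> I" "Domain K \<subseteq> \<Lambda>" "Range K \<subseteq> \<Lambda>"
    using fk by (auto simp: partial_bij_def)
  have fin: "finite (Domain F)" "finite (Range F)" "finite (Domain K)" "finite (Range K)"
    using fk by (auto simp: finite_Domain finite_Range)
  \<comment> \<open>The new indices \<open>i\<close> and \<open>l\<close> enter already here,
    although the box below uses only the old ones: this prescribes \<open>\<beta>\<close> on the
    entries that the new indices bring.\<close>
  define Y where "Y = (\<lambda>(l, i). Q l i) ` (insert l (Domain K) \<times> insert i (Domain F))"
  define H where "H = generate M Y"
  have "Q b a \<in> carrier M" if "b \<in> insert l (Domain K)" "a \<in> insert i (Domain F)" for a b
    using that il dom by (intro Q.entry) auto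
  then have Y: "finite Y" "Y \<subseteq> carrier M" using fin by (auto simp: Y_def)
  have YH: "Q b a \<in> H" if "b \<in> insert l (Domain K)" "a \<in> insert i (Domain F)" for a b
    using that unfolding H_def Y_def by (intro generate.incl) auto
  have HM: "h \<in> carrier M" if "h \<in> H" for h
    using that M.generate_in_carrier[OF Y(2)] by (simp add: H_def)
  have \<beta>H: "\<beta> ` H = generate M (\<beta> ` Y)" "\<beta> \<in> iso (M\<lparr>carrier := H\<rparr>) (M\<lparr>carrier := \<beta> ` H\<rparr>)"
    using group_iso_image_generate[OF M M \<beta> Y(2)] by (simp_all add: H_def)
  have \<beta>M: "\<beta> ` carrier M = carrier M" using \<beta> by (auto simp: iso_def bij_betw_def)
  have match: "\<beta> (Q b a) = Q' (v b) (u a)" if "b \<in> Domain K" "a \<in> Domain F" for a b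
    using fk that Fu Kv by blast
  have base: "(i\<^sub>0, j\<^sub>0) \<in> F" "(l\<^sub>0, m\<^sub>0) \<in> K" using fk by auto
  have A: "fg_cs_subsemigroup (rees M I \<Lambda> Q) (Domain F \<times> H \<times> Domain K)"
    unfolding H_def
  proof (rule Q.rees_fg_cs_box)
    show "normalised_at (M\<lparr>carrier := generate M Y\<rparr>) (Domain F) (Domain K) Q i\<^sub>0 l\<^sub>0"
      using base dom q YH by (auto simp: normalised_at_def subset_iff H_def)
  qed (use fin dom Y in auto)
  have B: "fg_cs_subsemigroup (rees M I \<Lambda> Q') (Range F \<times> \<beta> ` H \<times> Range K)"
    unfolding \<beta>H(1)
  proof (rule Q'.rees_fg_cs_box)
    have "Q' b a \<in> \<beta> ` H" if "b \<in> Range K" "a \<in> Range F" for a b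
    proof -
      from that obtain a' b' where "(a', a) \<in> F" "(b', b) \<in> K" by auto
      then have "Q' b a = \<beta> (Q b' a')" "b' \<in> Domain K" "a' \<in> Domain F" using match Fu Kv by auto
      then show ?thesis using YH by auto
    qed
    then show "normalised_at (M\<lparr>carrier := generate M (\<beta> ` Y)\<rparr>) (Range F) (Range K) Q' j\<^sub>0 m\<^sub>0"
      using base dom q' by (auto simp: normalised_at_def subset_iff \<beta>H(1))
    show "\<beta> ` Y \<subseteq> carrier M" using Y(2) \<beta>M by auto
  qed (use fin dom Y in auto)
  define \<theta> where "\<theta> = (\<lambda>(i, h, l). (u i, \<beta> h, v l))"
  have "\<theta> \<in> sgrp_iso (rees (M\<lparr>carrier := H\<rparr>) (Domain F) (Domain K) Q)
      (rees (M\<lparr>carrier := \<beta> ` H\<rparr>) (Range F) (Range K) Q')"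
    unfolding \<theta>_def
  proof (rule rees_iso_intro[OF u \<beta>H(2) v])
    show "group (M\<lparr>carrier := H\<rparr>)"
      using M.generate_is_subgroup[OF Y(2)] by (simp add: H_def subgroup.subgroup_is_group M)
  qed (use YH match in auto)
  then have "\<exists>\<phi>\<in>sgrp_iso (rees M I \<Lambda> Q) (rees M I \<Lambda> Q'). \<forall>x\<in>Domain F \<times> H \<times> Domain K. \<phi> x = \<theta> x"
    using homogeneous_cs_extend[OF T Q.rees_completely_regular Q'.rees_completely_regular f A B]
    by (simp add: rees_restrict)
  then obtain \<phi> where \<phi>: "\<phi> \<in> sgrp_iso (rees M I \<Lambda> Q) (rees M I \<Lambda> Q')"
    and \<phi>\<theta>: "\<And>i h l. i \<in> Domain F \<Longrightarrow> h \<in> H \<Longrightarrow> l \<in> Domain K \<Longrightarrow> \<phi> (i, h, l) = (u i, \<beta> h, v l)"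
    by (auto simp: \<theta>_def)
  have one: "\<one>\<^bsub>M\<^esub> \<in> H" by (simp add: H_def generate.one)
  have "\<beta> \<one>\<^bsub>M\<^esub> = \<one>\<^bsub>M\<^esub>" using \<beta> M by (auto simp: iso_def intro: hom_one)
  then have "\<phi> (i\<^sub>0, \<one>\<^bsub>M\<^esub>, l\<^sub>0) = (j\<^sub>0, \<one>\<^bsub>M\<^esub>, m\<^sub>0)" using \<phi>\<theta> one base Fu Kv by auto
  from rees_iso_decompose[OF M M Q Q' \<phi> this] obtain \<psi> \<alpha> \<chi> where
    \<psi>: "bij_betw \<psi> I I" and \<chi>: "bij_betw \<chi> \<Lambda> \<Lambda>"
    and form: "\<And>i g l. i \<in> I \<Longrightarrow> g \<in> carrier M \<Longrightarrow> l \<in> \<Lambda> \<Longrightarrow> \<phi> (i, g, l) = (\<psi> i, \<alpha> g, \<chi> l)"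
    and entries: "\<And>l i. l \<in> \<Lambda> \<Longrightarrow> i \<in> I \<Longrightarrow> \<alpha> (Q l i) = Q' (\<chi> l) (\<psi> i)" by metis
  have base': "i\<^sub>0 \<in> Domain F" "l\<^sub>0 \<in> Domain K" using base by auto
  have eq: "\<psi> a = u a \<and> \<alpha> h = \<beta> h \<and> \<chi> b = v b" if "a \<in> Domain F" "h \<in> H" "b \<in> Domain K" for a h b
    using form[OF subsetD[OF dom(1)] HM subsetD[OF dom(3)], of a h b] \<phi>\<theta>[OF that] that by simp
  have \<psi>u: "\<psi> a = u a" if "a \<in> Domain F" for a using eq that one base' by blast
  have \<chi>v: "\<chi> b = v b" if "b \<in> Domain K" for b using eq that one base' by blast
  have \<alpha>\<beta>: "\<alpha> h = \<beta> h" if "h \<in> H" for h using eq that base' by blast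
  \<comment> \<open>The images come from bijections of the whole index sets that extend
    \<open>u\<close> and \<open>v\<close>, so the enlarged relations remain partial
    bijections.\<close>
  define F' where "F' = insert (i, \<psi> i) F"
  define K' where "K' = insert (l, \<chi> l) K"
  have F': "a \<in> insert i (Domain F) \<and> b = \<psi> a" if "(a, b) \<in> F'" for a b
    using that Fu \<psi>u unfolding F'_def by (metis insert_iff prod.inject)
  have K': "a \<in> insert l (Domain K) \<and> b = \<chi> a" if "(a, b) \<in> K'" for a b
    using that Kv \<chi>v unfolding K'_def by (metis insert_iff prod.inject)
  have "partial_bij F' I I"
    by (rule partial_bij_subset[OF partial_bij_graph[OF \<psi>]]) (use F' dom il in force)
  moreover have "partial_bij K' \<Lambda> \<Lambda>"
    by (rule partial_bij_subset[OF partial_bij_graph[OF \<chi>]]) (use K' dom il in force)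
  moreover have "\<beta> (Q b a) = Q' b' a'" if "(a, a') \<in> F'" "(b, b') \<in> K'" for a a' b b'
  proof -
    have ab: "a \<in> insert i (Domain F)" "b \<in> insert l (Domain K)" "a' = \<psi> a" "b' = \<chi> b"
      using F' K' that by auto
    have "a \<in> I" "b \<in> \<Lambda>" using ab(1,2) dom il by blast+
    then have "\<alpha> (Q b a) = Q' b' a'" using entries ab(3,4) by simp
    moreover have "\<beta> (Q b a) = \<alpha> (Q b a)" using ab(1,2) YH \<alpha>\<beta> by simp
    ultimately show ?thesis by simp
  qed
  ultimately have "partial_match \<beta> Q Q' I \<Lambda> (i\<^sub>0, j\<^sub>0) (l\<^sub>0, m\<^sub>0) F' K'"
    using fk by (auto simp: partial_match_def F'_def K'_def)
  then show ?thesis by (intro exI[of _ F'] exI[of _ K']) (auto simp: F'_def K'_def)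
qed

text \<open>Turns a back step into a forth step for the exchanged matrices and the inverse of
  \<open>\<beta>\<close>.\<close>

lemma partial_match_converse:
  assumes inj: "inj_on \<beta> A" and Q: "\<And>l i. l \<in> \<Lambda> \<Longrightarrow> i \<in> I \<Longrightarrow> Q l i \<in> A"
    and FK: "partial_match \<beta> Q Q' I \<Lambda> (i\<^sub>0, j\<^sub>0) (l\<^sub>0, m\<^sub>0) F K"
  shows "partial_match (inv_into A \<beta>) Q' Q I \<Lambda> (j\<^sub>0, i\<^sub>0) (m\<^sub>0, l\<^sub>0) (F\<inverse>) (K\<inverse>)"
proof -
  have "inv_into A \<beta> (Q' m j) = Q l i" if "(i, j) \<in> F" "(l, m) \<in> K" for i j l m
  proof -
    have "Q' m j = \<beta> (Q l i)" "i \<in> I" "l \<in> \<Lambda>"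
      using that FK by (auto simp: partial_match_def partial_bij_def)
    then show ?thesis using Q inj by simp
  qed
  then show ?thesis using FK by (auto simp: partial_match_def partial_bij_converse)
qed

text \<open>A task \<open>(i, l, j, m)\<close> asks for \<open>i\<close>, \<open>l\<close> in the
  domains and \<open>j\<close>, \<open>m\<close> in the ranges, and is met by one forth and one back
  step. The union of the chain gives the two bijections; entries match because they do so at each
  finite stage.\<close>

lemma partial_match_total:
  fixes M :: "('g, 'b) monoid_scheme" and I :: "'i set" and \<Lambda> :: "'l set"
  assumes M: "group M" and Q: "normalised_at M I \<Lambda> Q i\<^sub>0 l\<^sub>0" and Q': "normalised_at M I \<Lambda> Q' j\<^sub>0 m\<^sub>0"
    and T: "homogeneous_cs T" and f: "f \<in> sgrp_iso (rees M I \<Lambda> Q) T" "g \<in> sgrp_iso (rees M I \<Lambda> Q') T"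
    and \<beta>: "\<beta> \<in> iso M M" and count: "countable I" "countable \<Lambda>"
    and FK: "partial_match \<beta> Q Q' I \<Lambda> (i\<^sub>0, j\<^sub>0) (l\<^sub>0, m\<^sub>0) F K"
  obtains \<psi> \<chi> where "bij_betw \<psi> I I" "bij_betw \<chi> \<Lambda> \<Lambda>" "\<And>i j. (i, j) \<in> F \<Longrightarrow> \<psi> i = j"
    "\<And>l m. (l, m) \<in> K \<Longrightarrow> \<chi> l = m" "\<And>l i. l \<in> \<Lambda> \<Longrightarrow> i \<in> I \<Longrightarrow> \<beta> (Q l i) = Q' (\<chi> l) (\<psi> i)"
proof -
  define pm where "pm = partial_match \<beta> Q Q' I \<Lambda> (i\<^sub>0, j\<^sub>0) (l\<^sub>0, m\<^sub>0)"
  let ?\<gamma> = "inv_into (carrier M) \<beta>"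
  have inj: "inj_on \<beta> (carrier M)" and onto: "\<beta> ` carrier M = carrier M"
    using \<beta> by (auto simp: iso_def bij_betw_def)
  have \<gamma>: "?\<gamma> \<in> iso M M" using group.iso_set_sym[OF M \<beta>] .
  have \<gamma>inj: "inj_on ?\<gamma> (carrier M)" using \<gamma> by (auto simp: iso_def bij_betw_def)
  \<comment> \<open>Exchanging the sides twice produces the inverse of the inverse, which is
    identified with \<open>\<beta>\<close> on \<open>carrier M\<close>; all entries lie
    there.\<close>
  have \<gamma>\<gamma>: "inv_into (carrier M) ?\<gamma> x = \<beta> x" if "x \<in> carrier M" for x
    using that inj onto \<gamma>inj by (intro inv_into_f_eq) auto
  have backward: "\<exists>F' K'. pm F' K' \<and> F \<subseteq> F' \<and> K \<subseteq> K' \<and> j \<in> Range F' \<and> m \<in> Range K'"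
    if FK: "pm F K" and jm: "j \<in> I" "m \<in> \<Lambda>" for F K j m
  proof -
    have "partial_match ?\<gamma> Q' Q I \<Lambda> (j\<^sub>0, i\<^sub>0) (m\<^sub>0, l\<^sub>0) (F\<inverse>) (K\<inverse>)"
      by (rule partial_match_converse[OF inj _ FK[unfolded pm_def]]) (use Q in \<open>auto simp: normalised_at_def\<close>)
    from partial_match_extend[OF M Q' Q T f(2,1) \<gamma> this jm] obtain F' K' where
      *: "partial_match ?\<gamma> Q' Q I \<Lambda> (j\<^sub>0, i\<^sub>0) (m\<^sub>0, l\<^sub>0) F' K'" "F\<inverse> \<subseteq> F'" "K\<inverse> \<subseteq> K'"
      "j \<in> Domain F'" "m \<in> Domain K'" by auto
    have "partial_match (inv_into (carrier M) ?\<gamma>) Q Q' I \<Lambda> (i\<^sub>0, j\<^sub>0) (l\<^sub>0, m\<^sub>0) (F'\<inverse>) (K'\<inverse>)"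
      by (rule partial_match_converse[OF \<gamma>inj _ *(1)]) (use Q' in \<open>auto simp: normalised_at_def\<close>)
    moreover have "inv_into (carrier M) ?\<gamma> (Q l i) = \<beta> (Q l i)" if "(i, j) \<in> F'\<inverse>" "(l, m) \<in> K'\<inverse>" for i j l m
    proof -
      have "i \<in> I" "l \<in> \<Lambda>" using that *(1) by (auto simp: partial_match_def partial_bij_def)
      then show ?thesis using Q by (intro \<gamma>\<gamma>) (simp add: normalised_at_def)
    qed
    ultimately have "pm (F'\<inverse>) (K'\<inverse>)" unfolding pm_def partial_match_def by fastforce
    then show ?thesis using *(2-5) by (intro exI[of _ "F'\<inverse>"] exI[of _ "K'\<inverse>"]) auto
  qed
  define D where "D = (\<lambda>(i :: 'i, l :: 'l, j :: 'i, m :: 'l) (F, K). i \<in> Domain F \<and> l \<in> Domain K \<and> j \<in> Range F \<and> m \<in> Range K)"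
  have step: "\<exists>s'. case_prod pm s' \<and> (fst s \<subseteq> fst s' \<and> snd s \<subseteq> snd s') \<and> D t s'"
    if s: "case_prod pm s" and t: "t \<in> I \<times> \<Lambda> \<times> I \<times> \<Lambda>" for s t
  proof -
    obtain F K where sFK: "s = (F, K)" by (cases s)
    obtain i l j m where til: "t = (i, l, j, m)" "i \<in> I" "l \<in> \<Lambda>" "j \<in> I" "m \<in> \<Lambda>" using t by auto
    obtain F1 K1 where 1: "pm F1 K1" "F \<subseteq> F1" "K \<subseteq> K1" "i \<in> Domain F1" "l \<in> Domain K1"
      using partial_match_extend[OF M Q Q' T f \<beta> _ til(2,3), of F K] s by (auto simp: pm_def sFK)
    obtain F2 K2 where 2: "pm F2 K2" "F1 \<subseteq> F2" "K1 \<subseteq> K2" "j \<in> Range F2" "m \<in> Range K2"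
      using backward[OF 1(1) til(4,5)] by auto
    show ?thesis
      using 1 2 by (intro exI[of _ "(F2, K2)"]) (auto simp: D_def til(1) sFK)
  qed
  have "\<exists>s :: nat \<Rightarrow> _. s 0 = (F, K) \<and> (\<forall>n. case_prod pm (s n)) \<and>
    (\<forall>m n. m \<le> n \<longrightarrow> fst (s m) \<subseteq> fst (s n) \<and> snd (s m) \<subseteq> snd (s n)) \<and>
    (\<forall>t\<in>I \<times> \<Lambda> \<times> I \<times> \<Lambda>. \<exists>n. D t (s n))" (is "\<exists>s. ?chain s")
  proof (rule increasing_chain)
    show "countable (I \<times> \<Lambda> \<times> I \<times> \<Lambda>)" using count by simp
    show "case_prod pm (F, K)" using FK by (simp add: pm_def)
  qed (use step in auto)
  then obtain s where "?chain s" ..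
  then have "s 0 = (F, K)" and "\<forall>n. case_prod pm (s n)"
    and "\<forall>m n. m \<le> n \<longrightarrow> fst (s m) \<subseteq> fst (s n) \<and> snd (s m) \<subseteq> snd (s n)"
    and "\<forall>t\<in>I \<times> \<Lambda> \<times> I \<times> \<Lambda>. \<exists>n. D t (s n)" by simp_all
  note s = this(1) this(2)[THEN spec] this(3)[THEN spec, THEN spec, THEN mp] this(4)[THEN bspec]
  have sp: "pm (fst (s n)) (snd (s n))" for n using s(2)[of n] by (simp add: case_prod_beta)
  define U where "U = (\<Union>n. fst (s n))"
  define V where "V = (\<Union>n. snd (s n))"
  have i0: "i\<^sub>0 \<in> I" "l\<^sub>0 \<in> \<Lambda>" using Q by (auto simp: normalised_at_def)
  have D: "\<exists>n. i \<in> Domain (fst (s n)) \<and> l \<in> Domain (snd (s n)) \<and> j \<in> Range (fst (s n)) \<and> m \<in> Range (snd (s n))"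
    if "i \<in> I" "l \<in> \<Lambda>" "j \<in> I" "m \<in> \<Lambda>" for i l j m
    using s(4)[of "(i, l, j, m)"] that by (auto simp: D_def case_prod_beta)
  have UV: "partial_bij U I I" "partial_bij V \<Lambda> \<Lambda>"
    unfolding U_def V_def
    by (rule partial_bij_Union; use sp s(3) in \<open>auto simp: pm_def partial_match_def\<close>)+
  \<comment> \<open>The base indices fill the remaining components of the task.\<close>
  have "\<exists>n. a \<in> Domain (fst (s n))" "\<exists>n. a \<in> Range (fst (s n))" if "a \<in> I" for a
    using D[OF that i0(2) i0] D[OF i0 that i0(2)] by blast+
  then have total: "I \<subseteq> Domain U" "I \<subseteq> Range U"
    unfolding U_def Domain_Union Range_Union by (simp_all add: subset_iff)
  have "\<exists>n. a \<in> Domain (snd (s n))" "\<exists>n. a \<in> Range (snd (s n))" if "a \<in> \<Lambda>" for a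
    using D[OF i0(1) that i0] D[OF i0 i0(1) that] by blast+
  then have total': "\<Lambda> \<subseteq> Domain V" "\<Lambda> \<subseteq> Range V"
    unfolding V_def Domain_Union Range_Union by (simp_all add: subset_iff)
  obtain \<psi> where \<psi>: "bij_betw \<psi> I I" "\<And>a b. (a, b) \<in> U \<longleftrightarrow> a \<in> I \<and> b = \<psi> a"
    using partial_bij_total[OF UV(1) total(1,2)] by blast
  obtain \<chi> where \<chi>: "bij_betw \<chi> \<Lambda> \<Lambda>" "\<And>a b. (a, b) \<in> V \<longleftrightarrow> a \<in> \<Lambda> \<and> b = \<chi> a"
    using partial_bij_total[OF UV(2) total'] by blast
  show ?thesis
  proof
    have "F \<subseteq> U" "K \<subseteq> V" using s(1) unfolding U_def V_def by (metis UN_upper UNIV_I fst_conv snd_conv)+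
    then show "(i, j) \<in> F \<Longrightarrow> \<psi> i = j" "(l, m) \<in> K \<Longrightarrow> \<chi> l = m" for i j l m
      using \<psi>(2) \<chi>(2) by auto
    show "\<beta> (Q l i) = Q' (\<chi> l) (\<psi> i)" if li: "l \<in> \<Lambda>" "i \<in> I" for l i
    proof -
      \<comment> \<open>A single task names \<open>i\<close> and \<open>l\<close> together, so both
        pairs come from the same stage.\<close>
      obtain n i' l' where *: "(i, i') \<in> fst (s n)" "(l, l') \<in> snd (s n)"
        using D[OF li(2,1) i0] by blast
      then have "(i, i') \<in> U" "(l, l') \<in> V" by (auto simp: U_def V_def)
      then have "i' = \<psi> i" "l' = \<chi> l" using \<psi>(2) \<chi>(2) by auto
      then show ?thesis using sp[of n] * by (auto simp: pm_def partial_match_def)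
    qed
  qed (use \<psi> \<chi> in auto)
qed

lemma completely_simple_idempotent:
  assumes "completely_simple (S\<lparr>carrier := A\<rparr>)"
  obtains e where "e \<in> A" "e \<cdot>\<^bsub>S\<^esub> e = e"
  using assms by (auto simp: completely_simple_def idempotents_def)

lemma partial_bij_mono: "partial_bij F A B \<Longrightarrow> A \<subseteq> A' \<Longrightarrow> B \<subseteq> B' \<Longrightarrow> partial_bij F A' B'"
  unfolding partial_bij_def by blast

section \<open>Homogeneity of the semigroup from that of its group and its idempotent part\<close>

context rees_matrix
begin

text \<open>\<open>N\<close> links two levels: homogeneity of \<open>G\<close> extends the group
  part of \<open>\<theta>\<close> to \<open>\<beta>\<close>, invariance lets \<open>\<beta>\<close>
  act on \<open>N\<close>, and homogeneity over \<open>N\<close> extends the index maps compatibly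
  with \<open>\<beta>\<close>.\<close>

lemma rees_homogeneousI:
  assumes G: "homogeneous_group G" and N: "subgroup N G" "\<And>l i. l \<in> \<Lambda> \<Longrightarrow> i \<in> I \<Longrightarrow> P l i \<in> N"
    and char: "\<And>\<beta>. \<beta> \<in> iso G G \<Longrightarrow> \<beta> ` N = N"
    and T: "homogeneous_cs (rees (G\<lparr>carrier := N\<rparr>) I \<Lambda> P)"
    and count: "countable I" "countable \<Lambda>" and ne: "I \<noteq> {}" "\<Lambda> \<noteq> {}"
  shows "homogeneous_cs (rees G I \<Lambda> P)"
  unfolding homogeneous_cs_def
proof (intro conjI allI ballI impI rees_completely_simple ne)
  define S where "S = rees G I \<Lambda> P"
  define M where "M = G\<lparr>carrier := N\<rparr>"
  fix A B \<theta>
  assume "\<theta> \<in> sgrp_iso ((rees G I \<Lambda> P)\<lparr>carrier := A\<rparr>) ((rees G I \<Lambda> P)\<lparr>carrier := B\<rparr>)"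
    "fg_cs_subsemigroup (rees G I \<Lambda> P) A \<and> fg_cs_subsemigroup (rees G I \<Lambda> P) B"
  then have \<theta>: "\<theta> \<in> sgrp_iso (S\<lparr>carrier := A\<rparr>) (S\<lparr>carrier := B\<rparr>)"
    and A: "fg_cs_subsemigroup S A" and B: "fg_cs_subsemigroup S B"
    by (simp_all add: S_def)
  have crS: "completely_regular S" using rees_completely_regular by (simp add: S_def)
  note sgS = completely_regular_semigroup[OF crS]
  have M: "group M" using subgroup.subgroup_is_group[OF N(1) is_group] by (simp add: M_def)
  have AS: "A \<subseteq> carrier S" and BS: "B \<subseteq> carrier S"
    using A B crS by (simp_all add: fg_cs_subsemigroup_subset)
  \<comment> \<open>Any idempotent of \<open>A\<close> serves as base point. Its image in
    \<open>B\<close> may have other indices, hence the two renormalisations \<open>Q\<close> and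
    \<open>Q'\<close>.\<close>
  obtain e where e: "e \<in> A" "e \<cdot>\<^bsub>S\<^esub> e = e"
    using A completely_simple_idempotent[of A S] by (auto simp: fg_cs_subsemigroup_def)
  then have "e \<in> idempotents S" using AS by (auto simp: idempotents_def)
  then obtain i\<^sub>0 l\<^sub>0 where il: "i\<^sub>0 \<in> I" "l\<^sub>0 \<in> \<Lambda>" and e_eq: "e = (i\<^sub>0, inv (P l\<^sub>0 i\<^sub>0), l\<^sub>0)"
    by (auto simp: S_def rees_idempotents)
  have \<theta>e: "\<theta> e \<in> B" "\<theta> e \<cdot>\<^bsub>S\<^esub> \<theta> e = \<theta> e"
    using sgrp_isoD(2)[OF \<theta>, of e] sgrp_isoD(3)[OF \<theta>, of e e] e by simp_all
  then have "\<theta> e \<in> idempotents S" using BS by (auto simp: idempotents_def)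
  then obtain j\<^sub>0 m\<^sub>0 where jm: "j\<^sub>0 \<in> I" "m\<^sub>0 \<in> \<Lambda>" and \<theta>e_eq: "\<theta> e = (j\<^sub>0, inv (P m\<^sub>0 j\<^sub>0), m\<^sub>0)"
    by (auto simp: S_def rees_idempotents)
  define Q where "Q = renormalise G P i\<^sub>0 l\<^sub>0"
  define Q' where "Q' = renormalise G P j\<^sub>0 m\<^sub>0"
  define f where "f = renormalise_map G P i\<^sub>0 l\<^sub>0"
  define g where "g = renormalise_map G P j\<^sub>0 m\<^sub>0"
  define R where "R = rees G I \<Lambda> Q"
  define R' where "R' = rees G I \<Lambda> Q'"
  have nQ: "normalised_at G I \<Lambda> Q i\<^sub>0 l\<^sub>0" and nQ': "normalised_at G I \<Lambda> Q' j\<^sub>0 m\<^sub>0"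
    using renormalise_normalised_at[OF il subgroup_self] renormalise_normalised_at[OF jm subgroup_self]
    by (simp_all add: Q_def Q'_def)
  have nM: "normalised_at M I \<Lambda> Q i\<^sub>0 l\<^sub>0" "normalised_at M I \<Lambda> Q' j\<^sub>0 m\<^sub>0"
    using renormalise_normalised_at[OF il N] renormalise_normalised_at[OF jm N]
    by (simp_all add: Q_def Q'_def M_def)
  have f: "f \<in> sgrp_iso R S" and g: "g \<in> sgrp_iso R' S"
    using renormalise_map_iso[OF il subgroup_self] renormalise_map_iso[OF jm subgroup_self]
    by (simp_all add: Q_def Q'_def R_def R'_def S_def f_def g_def)
  \<comment> \<open>The same maps \<open>f\<close> and \<open>g\<close> work over \<open>N\<close>,
    because the entries lie in \<open>N\<close>.\<close>
  have fM: "f \<in> sgrp_iso (rees M I \<Lambda> Q) (rees M I \<Lambda> P)" and gM: "g \<in> sgrp_iso (rees M I \<Lambda> Q') (rees M I \<Lambda> P)"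
    using renormalise_map_iso[OF il N] renormalise_map_iso[OF jm N]
    by (simp_all add: Q_def Q'_def M_def f_def g_def)
  interpret Q: rees_matrix G I \<Lambda> Q using nQ by unfold_locales (auto simp: normalised_at_def)
  interpret Q': rees_matrix G I \<Lambda> Q' using nQ' by unfold_locales (auto simp: normalised_at_def)
  define f' where "f' = inv_into (carrier R) f"
  define g' where "g' = inv_into (carrier R') g"
  have f': "f' \<in> sgrp_iso S R"
    using sgrp_iso_inv_into[OF Q.rees_semigroup] f by (simp add: f'_def R_def)
  have g': "g' \<in> sgrp_iso S R'"
    using sgrp_iso_inv_into[OF Q'.rees_semigroup] g by (simp add: g'_def R'_def)
  have ff': "f (f' x) = x" "g (g' x) = x" if "x \<in> carrier S" for x
    using that sgrp_isoD(5)[OF f] sgrp_isoD(5)[OF g] by (simp_all add: f'_def g'_def f_inv_into_f)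
  have f'f: "f' (f x) = x" if "x \<in> carrier R" for x
    using that sgrp_isoD(4)[OF f] by (simp add: f'_def)
  have g'g: "g' (g x) = x" if "x \<in> carrier R'" for x
    using that sgrp_isoD(4)[OF g] by (simp add: g'_def)
  have "f (i\<^sub>0, \<one>, l\<^sub>0) = e" "g (j\<^sub>0, \<one>, m\<^sub>0) = \<theta> e"
    using renormalise_map_one[OF il] renormalise_map_one[OF jm] e_eq \<theta>e_eq
    by (simp_all add: f_def g_def)
  then have base: "f' e = (i\<^sub>0, \<one>, l\<^sub>0)" "g' (\<theta> e) = (j\<^sub>0, \<one>, m\<^sub>0)"
    using f'f[of "(i\<^sub>0, \<one>, l\<^sub>0)"] g'g[of "(j\<^sub>0, \<one>, m\<^sub>0)"] il jm by (simp_all add: R_def R'_def)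
  have "(i\<^sub>0, \<one>, l\<^sub>0) \<in> f' ` A" using base(1) e(1) by (metis imageI)
  from Q.rees_fg_cs_is_box[OF nQ sgrp_iso_fg_cs_subsemigroup[OF crS f' A, unfolded R_def] this]
  obtain J K H where JK: "finite J" "finite K" "J \<subseteq> I" "K \<subseteq> \<Lambda>" and H: "fg_subgroup G H"
    and nH: "normalised_at (G\<lparr>carrier := H\<rparr>) J K Q i\<^sub>0 l\<^sub>0" and A_box: "f' ` A = J \<times> H \<times> K" by auto
  have "(j\<^sub>0, \<one>, m\<^sub>0) \<in> g' ` B" using base(2) \<theta>e(1) by (metis imageI)
  from Q'.rees_fg_cs_is_box[OF nQ' sgrp_iso_fg_cs_subsemigroup[OF crS g' B, unfolded R'_def] this]
  obtain J' K' H' where JK': "J' \<subseteq> I" "K' \<subseteq> \<Lambda>" and H': "fg_subgroup G H'"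
    and nH': "normalised_at (G\<lparr>carrier := H'\<rparr>) J' K' Q' j\<^sub>0 m\<^sub>0" and B_box: "g' ` B = J' \<times> H' \<times> K'" by auto
  have f'A: "f' ` A \<subseteq> carrier R" using AS sgrp_isoD(2)[OF f'] by auto
  have "f ` f' ` A = A" using AS ff'(1) by (force simp: image_image)
  then have "f \<in> sgrp_iso (R\<lparr>carrier := J \<times> H \<times> K\<rparr>) (S\<lparr>carrier := A\<rparr>)"
    using sgrp_iso_restrict[OF f f'A] by (simp add: A_box)
  moreover have "g' \<in> sgrp_iso (S\<lparr>carrier := B\<rparr>) (R'\<lparr>carrier := J' \<times> H' \<times> K'\<rparr>)"
    using sgrp_iso_restrict[OF g' BS] by (simp add: B_box)
  ultimately have \<theta>': "g' \<circ> (\<theta> \<circ> f) \<in> sgrp_iso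
      (rees (G\<lparr>carrier := H\<rparr>) J K Q) (rees (G\<lparr>carrier := H'\<rparr>) J' K' Q')"
    using \<theta> unfolding R_def R'_def rees_restrict by (intro sgrp_iso_compose)
  have gH: "group (G\<lparr>carrier := H\<rparr>)" "group (G\<lparr>carrier := H'\<rparr>)"
    using H H' generate_is_subgroup by (auto simp: fg_subgroup_def intro: subgroup.subgroup_is_group is_group)
  have "(g' \<circ> (\<theta> \<circ> f)) (i\<^sub>0, \<one>\<^bsub>G\<lparr>carrier := H\<rparr>\<^esub>, l\<^sub>0) = (j\<^sub>0, \<one>\<^bsub>G\<lparr>carrier := H'\<rparr>\<^esub>, m\<^sub>0)"
    using \<open>f (i\<^sub>0, \<one>, l\<^sub>0) = e\<close> base(2) by simp
  from rees_iso_decompose[OF gH nH nH' \<theta>' this] obtain u \<beta>\<^sub>0 v where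
    u: "bij_betw u J J'" and \<beta>\<^sub>0: "\<beta>\<^sub>0 \<in> iso (G\<lparr>carrier := H\<rparr>) (G\<lparr>carrier := H'\<rparr>)" and v: "bij_betw v K K'"
    and form': "\<And>i h l. i \<in> J \<Longrightarrow> h \<in> carrier (G\<lparr>carrier := H\<rparr>) \<Longrightarrow> l \<in> K \<Longrightarrow>
      (g' \<circ> (\<theta> \<circ> f)) (i, h, l) = (u i, \<beta>\<^sub>0 h, v l)"
    and entries: "\<And>l i. l \<in> K \<Longrightarrow> i \<in> J \<Longrightarrow> \<beta>\<^sub>0 (Q l i) = Q' (v l) (u i)"
    and uv: "u i\<^sub>0 = j\<^sub>0" "v l\<^sub>0 = m\<^sub>0" by metis
  have form: "g' (\<theta> (f (i, h, l))) = (u i, \<beta>\<^sub>0 h, v l)" if "i \<in> J" "h \<in> H" "l \<in> K" for i h l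
    using form'[of i h l] that by simp
  obtain \<beta> where \<beta>: "\<beta> \<in> iso G G" and \<beta>\<beta>\<^sub>0: "\<And>h. h \<in> H \<Longrightarrow> \<beta> h = \<beta>\<^sub>0 h"
    using G \<beta>\<^sub>0 H H' unfolding homogeneous_group_def by blast
  \<comment> \<open>Here the invariance of \<open>N\<close> enters, making \<open>\<beta>\<close>
    restrict to an automorphism of \<open>M\<close>.\<close>
  have \<beta>M: "\<beta> \<in> iso M M"
    using \<beta> char[OF \<beta>] subgroup.mem_carrier[OF N(1)]
    by (auto simp: M_def iso_def hom_def bij_betw_def inj_on_def)
  define F where "F = (\<lambda>i. (i, u i)) ` J"
  define L where "L = (\<lambda>l. (l, v l)) ` K"
  have "partial_match \<beta> Q Q' I \<Lambda> (i\<^sub>0, j\<^sub>0) (l\<^sub>0, m\<^sub>0) F L"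
    unfolding partial_match_def
  proof (intro conjI allI impI)
    show "partial_bij F I I"
      unfolding F_def by (rule partial_bij_mono[OF partial_bij_graph[OF u] JK(3) JK'(1)])
    show "partial_bij L \<Lambda> \<Lambda>"
      unfolding L_def by (rule partial_bij_mono[OF partial_bij_graph[OF v] JK(4) JK'(2)])
    show "(i\<^sub>0, j\<^sub>0) \<in> F" "(l\<^sub>0, m\<^sub>0) \<in> L"
      using nH uv by (auto simp: F_def L_def normalised_at_def)
    show "\<beta> (Q l i) = Q' m j" if "(i, j) \<in> F" "(l, m) \<in> L" for i j l m
      using that entries \<beta>\<beta>\<^sub>0 nH by (auto simp: F_def L_def normalised_at_def)
  qed (use JK in \<open>auto simp: F_def L_def\<close>)
  then obtain \<psi> \<chi> where \<psi>\<chi>: "bij_betw \<psi> I I" "bij_betw \<chi> \<Lambda> \<Lambda>" "\<And>i j. (i, j) \<in> F \<Longrightarrow> \<psi> i = j"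
    "\<And>l m. (l, m) \<in> L \<Longrightarrow> \<chi> l = m"
    and PQ: "\<And>l i. l \<in> \<Lambda> \<Longrightarrow> i \<in> I \<Longrightarrow> \<beta> (Q l i) = Q' (\<chi> l) (\<psi> i)"
    by (rule partial_match_total[OF M nM T[folded M_def] fM gM \<beta>M count]) (rule that)
  \<comment> \<open>The index maps found over \<open>N\<close> are combined with
    \<open>\<beta>\<close> on all of \<open>G\<close>; for an isomorphism it suffices that the
    entries match.\<close>
  define \<phi> where "\<phi> = (\<lambda>(i, g, l). (\<psi> i, \<beta> g, \<chi> l))"
  have \<phi>: "\<phi> \<in> sgrp_iso R R'"
    unfolding \<phi>_def R_def R'_def
    by (rule rees_iso_intro[OF \<psi>\<chi>(1) \<beta> \<psi>\<chi>(2) is_group]) (use PQ in auto)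
  have "(g \<circ> (\<phi> \<circ> f')) x = \<theta> x" if x: "x \<in> A" for x
  proof -
    obtain i h l where ihl: "f' x = (i, h, l)" "i \<in> J" "h \<in> H" "l \<in> K" using A_box x by blast
    have "\<phi> (f' x) = g' (\<theta> (f (f' x)))"
      using ihl form \<psi>\<chi>(3)[of i "u i"] \<psi>\<chi>(4)[of l "v l"] \<beta>\<beta>\<^sub>0 by (auto simp: \<phi>_def F_def L_def)
    moreover have "\<theta> x \<in> carrier S" using x sgrp_isoD(2)[OF \<theta>, of x] BS by auto
    ultimately show ?thesis using ff'(1)[OF subsetD[OF AS x]] ff'(2)[of "\<theta> x"] by simp
  qed
  moreover have "g \<circ> (\<phi> \<circ> f') \<in> sgrp_iso S S"
    using f' \<phi> g by (intro sgrp_iso_compose)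
  ultimately show "\<exists>\<phi>\<in>sgrp_iso (rees G I \<Lambda> P) (rees G I \<Lambda> P). \<forall>x\<in>A. \<phi> x = \<theta> x"
    unfolding S_def by blast
qed

end

subsection \<open>Homogeneous Rees matrix semigroups\<close>

locale normalised_rees_matrix = rees_matrix G I \<Lambda> P
  for G :: "('g, 'b) monoid_scheme" (structure) and I :: "'i set" and \<Lambda> :: "'l set"
    and P :: "'l \<Rightarrow> 'i \<Rightarrow> 'g" +
  fixes i\<^sub>1 :: 'i and l\<^sub>1 :: 'l
  assumes norm: "normalised_at G I \<Lambda> P i\<^sub>1 l\<^sub>1"
begin

lemma base [simp]: "i\<^sub>1 \<in> I" "l\<^sub>1 \<in> \<Lambda>" "i \<in> I \<Longrightarrow> P l\<^sub>1 i = \<one>" "l \<in> \<Lambda> \<Longrightarrow> P l i\<^sub>1 = \<one>"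
  using norm by (auto simp: normalised_at_def)

text \<open>Idempotents have inverses of entries in the middle, and the entries form a subgroup, so
  nothing outside the box over it is generated. Conversely, each element of that box is a product of
  four idempotents.\<close>

lemma idempotent_generated_rees:
  assumes N: "subgroup (matrix_entries I \<Lambda> P) G"
  shows "idempotent_generated (rees G I \<Lambda> P) = rees (G\<lparr>carrier := matrix_entries I \<Lambda> P\<rparr>) I \<Lambda> P"
proof -
  let ?R = "rees G I \<Lambda> P" and ?N = "matrix_entries I \<Lambda> P"
  note Nc = subgroup.m_closed[OF N] subgroup.m_inv_closed[OF N] subgroup.mem_carrier[OF N]
  have PN: "P l i \<in> ?N" if "l \<in> \<Lambda>" "i \<in> I" for l i
    using that by (auto simp: matrix_entries_def)
  have "sgrp_generate ?R (idempotents ?R) \<subseteq> I \<times> ?N \<times> \<Lambda>"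
  proof (rule sgrp_generate_subset)
    show "idempotents ?R \<subseteq> I \<times> ?N \<times> \<Lambda>" using PN Nc by (auto simp: rees_idempotents)
    show "x \<cdot>\<^bsub>?R\<^esub> y \<in> I \<times> ?N \<times> \<Lambda>" if "x \<in> I \<times> ?N \<times> \<Lambda>" "y \<in> I \<times> ?N \<times> \<Lambda>" for x y
      using that PN Nc by auto
    show "sgrp_inv ?R x \<in> I \<times> ?N \<times> \<Lambda>" if "x \<in> I \<times> ?N \<times> \<Lambda>" for x
      using that PN Nc by (auto simp: rees_inv)
  qed
  moreover have "(i, P m j, l) \<in> sgrp_generate ?R (idempotents ?R)"
    if "i \<in> I" "l \<in> \<Lambda>" "m \<in> \<Lambda>" "j \<in> I" for i l m j
  proof -
    have "(i, \<one>, l\<^sub>1) \<in> sgrp_generate ?R (idempotents ?R)" if "i \<in> I" for i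
      using that by (intro sgrp_generate.incl) (force simp: rees_idempotents)
    moreover have "(i\<^sub>1, \<one>, l) \<in> sgrp_generate ?R (idempotents ?R)" if "l \<in> \<Lambda>" for l
      using that by (intro sgrp_generate.incl) (force simp: rees_idempotents)
    \<comment> \<open>The inner product creates the entry \<open>P m j\<close>, and the outer
      factors then set the outer indices.\<close>
    ultimately have "(i, \<one>, l\<^sub>1) \<cdot>\<^bsub>?R\<^esub> ((i\<^sub>1, \<one>, m) \<cdot>\<^bsub>?R\<^esub> (j, \<one>, l\<^sub>1)) \<cdot>\<^bsub>?R\<^esub> (i\<^sub>1, \<one>, l)
        \<in> sgrp_generate ?R (idempotents ?R)"
      using that by (intro sgrp_generate.prod)
    then show ?thesis using that by simp
  qed
  ultimately have "sgrp_generate ?R (idempotents ?R) = I \<times> ?N \<times> \<Lambda>"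
    by (auto simp: matrix_entries_def)
  then show ?thesis by (simp add: idempotent_generated_def rees_restrict)
qed

end

section \<open>The group and the entries of a homogeneous Rees matrix semigroup\<close>

locale homogeneous_rees_matrix = normalised_rees_matrix G I \<Lambda> P i\<^sub>1 l\<^sub>1
  for G :: "('g, 'b) monoid_scheme" (structure) and I :: "'i set" and \<Lambda> :: "'l set"
    and P :: "'l \<Rightarrow> 'i \<Rightarrow> 'g" and i\<^sub>1 l\<^sub>1 +
  assumes hom: "homogeneous_cs (rees G I \<Lambda> P)"
begin

text \<open>Column \<open>i\<^sub>1\<close> is trivial, so
  \<open>{i\<^sub>1} \<times> A \<times> M\<close> is the direct product of \<open>A\<close> and a
  right zero band. Hence \<open>\<theta>\<close> combines with any bijection \<open>k\<close> of
  rows, and \<open>k l\<^sub>1 = l\<^sub>1\<close> keeps the base idempotent fixed, so that the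
  extension decomposes.\<close>

lemma extend_row_iso:
  assumes A: "fg_subgroup G A" and B: "fg_subgroup G B"
    and \<theta>: "\<theta> \<in> iso (G\<lparr>carrier := A\<rparr>) (G\<lparr>carrier := B\<rparr>)"
    and M: "finite M" "M \<subseteq> \<Lambda>" "l\<^sub>1 \<in> M" and M': "M' \<subseteq> \<Lambda>" and k: "bij_betw k M M'" "k l\<^sub>1 = l\<^sub>1"
  obtains \<psi> \<alpha> \<chi> where "bij_betw \<psi> I I" "\<alpha> \<in> iso G G" "bij_betw \<chi> \<Lambda> \<Lambda>"
    "\<And>l i. l \<in> \<Lambda> \<Longrightarrow> i \<in> I \<Longrightarrow> \<alpha> (P l i) = P (\<chi> l) (\<psi> i)"
    "\<And>g. g \<in> A \<Longrightarrow> \<alpha> g = \<theta> g" "\<And>l. l \<in> M \<Longrightarrow> \<chi> l = k l"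
proof -
  obtain X Y where X: "finite X" "X \<subseteq> carrier G" "A = generate G X"
    and Y: "finite Y" "Y \<subseteq> carrier G" "B = generate G Y"
    using A B by (auto simp: fg_subgroup_def)
  have sub: "subgroup A G" "subgroup B G" using X Y generate_is_subgroup by auto
  have gA: "group (G\<lparr>carrier := A\<rparr>)" and gB: "group (G\<lparr>carrier := B\<rparr>)"
    using sub subgroup.subgroup_is_group is_group by auto
  have one: "\<theta> \<one> = \<one>" "\<one> \<in> A" "\<one> \<in> B"
    using hom_one[of \<theta> "G\<lparr>carrier := A\<rparr>" "G\<lparr>carrier := B\<rparr>"] \<theta> gA gB sub
    by (auto simp: iso_def subgroup.one_closed)
  have finM': "finite M'" "l\<^sub>1 \<in> M'"
    using k M(1) bij_betwE[OF k(1)] M(3) by (auto simp: bij_betw_finite)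
  have nA: "normalised_at (G\<lparr>carrier := A\<rparr>) {i\<^sub>1} M P i\<^sub>1 l\<^sub>1"
    and nB: "normalised_at (G\<lparr>carrier := B\<rparr>) {i\<^sub>1} M' P i\<^sub>1 l\<^sub>1"
    using M M' finM' one by (auto simp: normalised_at_def subset_iff)
  have boxA: "fg_cs_subsemigroup (rees G I \<Lambda> P) ({i\<^sub>1} \<times> A \<times> M)"
    and boxB: "fg_cs_subsemigroup (rees G I \<Lambda> P) ({i\<^sub>1} \<times> B \<times> M')"
    using rees_fg_cs_box[of "{i\<^sub>1}" M X] rees_fg_cs_box[of "{i\<^sub>1}" M' Y] X Y M M' finM' nA nB by auto
  \<comment> \<open>The identity on the single column index is written \<open>id i\<close> to fit
    the shape of \<open>rees_iso_intro\<close>.\<close>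
  define \<Theta> where "\<Theta> = (\<lambda>(i :: 'i, g, l). (id i, \<theta> g, k l))"
  have "\<Theta> \<in> sgrp_iso ((rees G I \<Lambda> P)\<lparr>carrier := {i\<^sub>1} \<times> A \<times> M\<rparr>)
      ((rees G I \<Lambda> P)\<lparr>carrier := {i\<^sub>1} \<times> B \<times> M'\<rparr>)"
    unfolding \<Theta>_def rees_restrict
  proof (rule rees_iso_intro[OF _ \<theta> k(1) gA])
    show "\<theta> (P l i) = P (k l) (id i)" if "l \<in> M" "i \<in> {i\<^sub>1}" for l i
      using that one M M' bij_betwE[OF k(1)] by (auto simp: subset_iff)
  qed (use nA in \<open>auto simp: normalised_at_def\<close>)
  from homogeneous_csD[OF hom this boxA boxB]
  obtain \<phi> where \<phi>: "\<phi> \<in> sgrp_iso (rees G I \<Lambda> P) (rees G I \<Lambda> P)"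
    and \<phi>\<Theta>: "\<And>g l. g \<in> A \<Longrightarrow> l \<in> M \<Longrightarrow> \<phi> (i\<^sub>1, g, l) = (i\<^sub>1, \<theta> g, k l)"
    by (auto simp: \<Theta>_def)
  have "\<phi> (i\<^sub>1, \<one>, l\<^sub>1) = (i\<^sub>1, \<one>, l\<^sub>1)" using \<phi>\<Theta> one M k by simp
  from rees_iso_decompose[OF is_group is_group norm norm \<phi> this] obtain \<psi> \<alpha> \<chi> where
    *: "bij_betw \<psi> I I" "\<alpha> \<in> iso G G" "bij_betw \<chi> \<Lambda> \<Lambda>"
    "\<And>l i. l \<in> \<Lambda> \<Longrightarrow> i \<in> I \<Longrightarrow> \<alpha> (P l i) = P (\<chi> l) (\<psi> i)"
    and form: "\<And>i g l. i \<in> I \<Longrightarrow> g \<in> carrier G \<Longrightarrow> l \<in> \<Lambda> \<Longrightarrow> \<phi> (i, g, l) = (\<psi> i, \<alpha> g, \<chi> l)"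
    by metis
  have eq: "\<alpha> g = \<theta> g \<and> \<chi> l = k l" if "g \<in> A" "l \<in> M" for g l
    using form[of i\<^sub>1 g l] \<phi>\<Theta>[OF that] that M subgroup.mem_carrier[OF sub(1)] by auto
  show ?thesis
    using that[OF *] eq one M by blast
qed

text \<open>The single row \<open>l\<^sub>1\<close> suffices, as
  \<open>{i\<^sub>1} \<times> carrier G \<times> {l\<^sub>1}\<close> is a copy of
  \<open>G\<close>.\<close>

lemma homogeneous_group_of_rees: "homogeneous_group G"
  unfolding homogeneous_group_def
proof (intro conjI allI ballI impI is_group)
  fix A B \<theta> assume \<theta>: "\<theta> \<in> iso (G\<lparr>carrier := A\<rparr>) (G\<lparr>carrier := B\<rparr>)" and AB: "fg_subgroup G A \<and> fg_subgroup G B"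
  obtain \<alpha> where "\<alpha> \<in> iso G G" "\<And>g. g \<in> A \<Longrightarrow> \<alpha> g = \<theta> g"
    by (rule extend_row_iso[of A B \<theta> "{l\<^sub>1}" "{l\<^sub>1}" id]) (use AB \<theta> in auto)
  then show "\<exists>\<alpha>\<in>iso G G. \<forall>g\<in>A. \<alpha> g = \<theta> g" by blast
qed

lemma fg_subgroup_cyclic: "g \<in> carrier G \<Longrightarrow> fg_subgroup G (generate G {g})"
  unfolding fg_subgroup_def by (intro exI[of _ "{g}"]) simp

text \<open>The automorphism \<open>\<alpha>\<close> obtained by extension comes from the semigroup
  and so sends entries to entries. It may differ from \<open>\<beta>\<close>, but agreement on the
  cyclic subgroup of \<open>a\<close> is enough.\<close>

lemma entries_iso_invariant:
  assumes \<beta>: "\<beta> \<in> iso G G"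
  shows "\<beta> ` matrix_entries I \<Lambda> P \<subseteq> matrix_entries I \<Lambda> P"
proof clarify
  fix a assume "a \<in> matrix_entries I \<Lambda> P"
  then obtain l i where a: "a = P l i" "l \<in> \<Lambda>" "i \<in> I" by (auto simp: matrix_entries_def)
  then have aG: "a \<in> carrier G" by simp
  then have \<beta>a: "\<beta> a \<in> carrier G" using \<beta> by (auto simp: iso_def hom_def)
  have \<beta>': "\<beta> \<in> iso (G\<lparr>carrier := generate G {a}\<rparr>) (G\<lparr>carrier := generate G {\<beta> a}\<rparr>)"
    using group_iso_image_generate[OF is_group is_group \<beta>, of "{a}"] aG by simp
  obtain \<psi> \<alpha> \<chi> where "bij_betw \<psi> I I" "bij_betw \<chi> \<Lambda> \<Lambda>"
    "\<And>l i. l \<in> \<Lambda> \<Longrightarrow> i \<in> I \<Longrightarrow> \<alpha> (P l i) = P (\<chi> l) (\<psi> i)"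
    "\<And>g. g \<in> generate G {a} \<Longrightarrow> \<alpha> g = \<beta> g"
    by (rule extend_row_iso[OF fg_subgroup_cyclic[OF aG] fg_subgroup_cyclic[OF \<beta>a] \<beta>', of "{l\<^sub>1}" "{l\<^sub>1}" id]) auto
  then have "\<beta> a = P (\<chi> l) (\<psi> i)" "\<chi> l \<in> \<Lambda>" "\<psi> i \<in> I"
    using a generate.incl[of a "{a}" G] bij_betwE by (metis singletonI)+
  then show "\<beta> a \<in> matrix_entries I \<Lambda> P" by (auto simp: matrix_entries_def)
qed

text \<open>The subsemigroup generated by \<open>(i\<^sub>1, b, l\<^sub>1)\<close> and \<open>(i\<^sub>1, \<one>, l)\<close> is the direct product of
  \<open>\<langle>b\<rangle>\<close> and a two-element right zero band, so \<open>l\<close> may be moved to any other row while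
  \<open>b\<close> is fixed.\<close>

lemma entry_in_every_row:
  assumes l: "l \<in> \<Lambda>" "l \<noteq> l\<^sub>1" and m: "m \<in> \<Lambda>" "m \<noteq> l\<^sub>1" and i: "i \<in> I"
  obtains j where "j \<in> I" "P l i = P m j"
proof -
  define b where "b = P l i"
  have bG: "b \<in> carrier G" using l i by (simp add: b_def)
  have id: "id \<in> iso (G\<lparr>carrier := generate G {b}\<rparr>) (G\<lparr>carrier := generate G {b}\<rparr>)"
    by (auto simp: iso_def hom_def)
  \<comment> \<open>\<open>l\<^sub>1\<close> is kept fixed as \<open>extend_row_iso\<close> demands;
    this is a bijection since \<open>l\<close> and \<open>m\<close> both differ from
    \<open>l\<^sub>1\<close>.\<close>
  define k where "k x = (if x = l\<^sub>1 then l\<^sub>1 else m)" for x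
  have k: "bij_betw k {l\<^sub>1, l} {l\<^sub>1, m}" using l m by (auto simp: bij_betw_def k_def)
  obtain \<psi> \<alpha> \<chi> where "bij_betw \<psi> I I"
    "\<And>l i. l \<in> \<Lambda> \<Longrightarrow> i \<in> I \<Longrightarrow> \<alpha> (P l i) = P (\<chi> l) (\<psi> i)"
    "\<And>g. g \<in> generate G {b} \<Longrightarrow> \<alpha> g = id g" "\<And>x. x \<in> {l\<^sub>1, l} \<Longrightarrow> \<chi> x = k x"
    by (rule extend_row_iso[OF fg_subgroup_cyclic[OF bG] fg_subgroup_cyclic[OF bG] id _ _ _ _ k])
      (use l m in \<open>auto simp: k_def\<close>)
  moreover have "k l = m" using l by (simp add: k_def)
  ultimately have "b = P m (\<psi> i)" "\<psi> i \<in> I"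
    using l i b_def generate.incl[of b "{b}" G] bij_betwE by (metis id_apply insertI1 insertI2)+
  then show ?thesis using that by (simp add: b_def)
qed

text \<open>Row \<open>l\<^sub>1\<close> is trivial, so the boxes over \<open>?C\<close> at
  \<open>(i, l\<^sub>1)\<close> and \<open>(i\<^sub>1, l\<^sub>1)\<close> are copies of one cyclic
  group, and moving the first to the second extends to \<open>\<phi>\<close>. After renormalising at
  \<open>(i, l\<^sub>1)\<close> the entry at \<open>(l, j)\<close> is the quotient \<open>c\<close>;
  the group part of \<open>\<phi>\<close> fixes \<open>c\<close> and sends it to an entry of
  \<open>P\<close>.\<close>

lemma row_quotient_entry:
  assumes l: "l \<in> \<Lambda>" and i: "i \<in> I" and j: "j \<in> I"
  shows "inv (P l i) \<otimes> P l j \<in> matrix_entries I \<Lambda> P"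
proof -
  define c where "c = inv (P l i) \<otimes> P l j"
  have cG: "c \<in> carrier G" using l i j by (simp add: c_def)
  let ?C = "generate G {c}"
  have C: "subgroup ?C G" using cG generate_is_subgroup by simp
  have n: "normalised_at (G\<lparr>carrier := ?C\<rparr>) {i} {l\<^sub>1} P i l\<^sub>1"
    "normalised_at (G\<lparr>carrier := ?C\<rparr>) {i\<^sub>1} {l\<^sub>1} P i\<^sub>1 l\<^sub>1"
    using i by (auto simp: normalised_at_def generate.one)
  have box: "fg_cs_subsemigroup (rees G I \<Lambda> P) ({i} \<times> ?C \<times> {l\<^sub>1})"
    "fg_cs_subsemigroup (rees G I \<Lambda> P) ({i\<^sub>1} \<times> ?C \<times> {l\<^sub>1})"
    using rees_fg_cs_box[of "{i}" "{l\<^sub>1}" "{c}"] rees_fg_cs_box[of "{i\<^sub>1}" "{l\<^sub>1}" "{c}"] n i cG by auto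
  define \<Theta> where "\<Theta> = (\<lambda>(x :: 'i, g :: 'g, l :: 'l). ((\<lambda>_. i\<^sub>1) x, id g, id l))"
  have "\<Theta> \<in> sgrp_iso ((rees G I \<Lambda> P)\<lparr>carrier := {i} \<times> ?C \<times> {l\<^sub>1}\<rparr>)
      ((rees G I \<Lambda> P)\<lparr>carrier := {i\<^sub>1} \<times> ?C \<times> {l\<^sub>1}\<rparr>)"
    unfolding \<Theta>_def rees_restrict
  proof (rule rees_iso_intro)
    show "group (G\<lparr>carrier := ?C\<rparr>)" using C is_group by (simp add: subgroup.subgroup_is_group)
    show "bij_betw (\<lambda>_. i\<^sub>1) {i} {i\<^sub>1}" by (simp add: bij_betw_def)
  qed (use i in \<open>auto simp: iso_def hom_def bij_betw_def generate.one\<close>)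
  from homogeneous_csD[OF hom this box]
  obtain \<phi> where \<phi>: "\<phi> \<in> sgrp_iso (rees G I \<Lambda> P) (rees G I \<Lambda> P)"
    and \<phi>\<Theta>: "\<And>g. g \<in> ?C \<Longrightarrow> \<phi> (i, g, l\<^sub>1) = (i\<^sub>1, g, l\<^sub>1)"
    by (auto simp: \<Theta>_def)
  define Q where "Q = renormalise G P i l\<^sub>1"
  define f where "f = renormalise_map G P i l\<^sub>1"
  have nQ: "normalised_at G I \<Lambda> Q i l\<^sub>1"
    using renormalise_normalised_at[OF i base(2) subgroup_self] by (simp add: Q_def)
  have f: "f \<in> sgrp_iso (rees G I \<Lambda> Q) (rees G I \<Lambda> P)"
    using renormalise_map_iso[OF i base(2) subgroup_self] by (simp add: Q_def f_def)
  \<comment> \<open>All scaling factors at \<open>(i, l\<^sub>1)\<close> are entries of the trivial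
    row or their inverses.\<close>
  have fg: "f (i, g, l\<^sub>1) = (i, g, l\<^sub>1)" if "g \<in> carrier G" for g
    using that i by (simp add: f_def renormalise_map_def)
  have "(\<phi> \<circ> f) (i, \<one>, l\<^sub>1) = (i\<^sub>1, \<one>, l\<^sub>1)" using fg \<phi>\<Theta> by (simp add: generate.one)
  from rees_iso_decompose[OF is_group is_group nQ norm sgrp_iso_compose[OF f \<phi>] this]
  obtain \<psi> \<alpha> \<chi> where \<psi>: "bij_betw \<psi> I I" and \<chi>: "bij_betw \<chi> \<Lambda> \<Lambda>"
    and form: "\<And>i g l. i \<in> I \<Longrightarrow> g \<in> carrier G \<Longrightarrow> l \<in> \<Lambda> \<Longrightarrow> (\<phi> \<circ> f) (i, g, l) = (\<psi> i, \<alpha> g, \<chi> l)"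
    and entries: "\<And>l i. l \<in> \<Lambda> \<Longrightarrow> i \<in> I \<Longrightarrow> \<alpha> (Q l i) = P (\<chi> l) (\<psi> i)" by metis
  have "\<phi> (f (i, c, l\<^sub>1)) = (i\<^sub>1, c, l\<^sub>1)" using fg cG \<phi>\<Theta> by (simp add: generate.incl)
  then have "\<alpha> c = c" using form[of i c l\<^sub>1] i cG by simp
  moreover have "Q l j = c" using l i j by (simp add: Q_def renormalise_def c_def)
  ultimately have "c = P (\<chi> l) (\<psi> j)" using entries[OF l j] by simp
  then show ?thesis
    using l j bij_betwE[OF \<psi>] bij_betwE[OF \<chi>] by (auto simp: c_def matrix_entries_def)
qed

text \<open>The trivial column \<open>i\<^sub>1\<close> turns row quotients into inverses. A product
  \<open>a b\<close> is the quotient of \<open>inv a\<close> and \<open>b\<close> once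
  \<open>b\<close> has been found in the row of \<open>inv a\<close>.\<close>

lemma entries_characteristic: "characteristic_subgroup (matrix_entries I \<Lambda> P) G"
proof -
  let ?N = "matrix_entries I \<Lambda> P"
  have inv: "inv a \<in> ?N" if a: "a \<in> ?N" for a
  proof -
    obtain l i where "a = P l i" "l \<in> \<Lambda>" "i \<in> I" using a by (auto simp: matrix_entries_def)
    then show ?thesis using row_quotient_entry[of l i i\<^sub>1] by simp
  qed
  have NG: "?N \<subseteq> carrier G" by (auto simp: matrix_entries_def)
  have mult: "a \<otimes> b \<in> ?N" if a: "a \<in> ?N" and b: "b \<in> ?N" for a b
  proof -
    obtain l i where l: "inv a = P l i" "l \<in> \<Lambda>" "i \<in> I" using inv[OF a] by (auto simp: matrix_entries_def)
    obtain m j where m: "b = P m j" "m \<in> \<Lambda>" "j \<in> I" using b by (auto simp: matrix_entries_def)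
    have ab: "a \<in> carrier G" "b \<in> carrier G" using a b NG by auto
    \<comment> \<open>Row \<open>l\<^sub>1\<close> holds only the identity, so entries cannot be
      moved into it; if it occurs, a factor is the identity.\<close>
    consider "l = l\<^sub>1" | "m = l\<^sub>1" | "l \<noteq> l\<^sub>1" "m \<noteq> l\<^sub>1" by blast
    then show ?thesis
    proof cases
      case 1
      then have "a = \<one>" using l ab by (metis base(3) inv_inv inv_one)
      then show ?thesis using b ab by simp
    next
      case 2
      then show ?thesis using m a ab by simp
    next
      case 3
      then obtain j' where "j' \<in> I" "b = P l j'" using entry_in_every_row[of m l j] l m by metis
      then have "inv (inv a) \<otimes> b \<in> ?N" using row_quotient_entry[of l i j'] l by simp
      then show ?thesis using ab by simp
    qed
  qed
  have "subgroup ?N G"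
  proof (rule subgroupI)
    have "P l\<^sub>1 i\<^sub>1 \<in> ?N" using base(1,2) unfolding matrix_entries_def by blast
    then show "?N \<noteq> {}" by blast
  qed (use NG inv mult in auto)
  moreover have "\<beta> ` ?N = ?N" if \<beta>: "\<beta> \<in> iso G G" for \<beta>
  proof
    show "\<beta> ` ?N \<subseteq> ?N" using entries_iso_invariant[OF \<beta>] .
    \<comment> \<open>The reverse inclusion is invariance under the inverse automorphism.\<close>
    have "inv_into (carrier G) \<beta> \<in> iso G G" using iso_set_sym[OF \<beta>] .
    from entries_iso_invariant[OF this] have "inv_into (carrier G) \<beta> x \<in> ?N" if "x \<in> ?N" for x
      using that by auto
    moreover have "\<beta> (inv_into (carrier G) \<beta> x) = x" if "x \<in> ?N" for x
      using that NG \<beta> by (auto simp: iso_def bij_betw_def intro!: f_inv_into_f)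
    ultimately show "?N \<subseteq> \<beta> ` ?N" by (metis imageI subsetI)
  qed
  ultimately show ?thesis by (simp add: characteristic_subgroup_def)
qed

end

section \<open>Homogeneity of the idempotent-generated part\<close>

text \<open>Automorphisms of \<open>S\<close> permute the idempotents and so restrict to
  \<open>T\<close>. It remains to see that finitely generated subsemigroups of \<open>T\<close> are
  finitely generated in \<open>S\<close>.\<close>

lemma homogeneous_idempotent_generated:
  assumes hom: "homogeneous_cs S" and crS: "completely_regular S"
    and T: "T = idempotent_generated S" and csT: "completely_simple T" and crT: "completely_regular T"
  shows "homogeneous_cs T"
proof -
  let ?C = "sgrp_generate S (idempotents S)"
  have TS: "T\<lparr>carrier := A\<rparr> = S\<lparr>carrier := A\<rparr>" for A by (simp add: T idempotent_generated_def)
  have cT: "carrier T = ?C" and sprod: "sprod T = sprod S" by (simp_all add: T idempotent_generated_def)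
  have ES: "idempotents S \<subseteq> carrier S" by (auto simp: idempotents_def)
  have CS: "?C \<subseteq> carrier S" using sgrp_generate_carrier[OF crS ES] .
  \<comment> \<open>\<open>sgrp_inv T\<close> refers to maximal subgroups of \<open>T\<close>, but
    its value is a commuting inverse in \<open>S\<close> too, where such an inverse is
    unique.\<close>
  have inv: "sgrp_inv S x = sgrp_inv T x" if "x \<in> ?C" for x
    using completely_regular_inv[OF crT, of x] that CS
    by (intro sgrp_inv_eqI completely_regular_semigroup[OF crS]) (auto simp: cT sprod)
  have gen: "sgrp_generate T X = sgrp_generate S X" if X: "X \<subseteq> ?C" for X
  proof
    have sub: "sgrp_generate T X \<subseteq> ?C" using sgrp_generate_carrier[OF crT, of X] X by (simp add: cT)
    show "sgrp_generate S X \<subseteq> sgrp_generate T X"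
    proof (rule sgrp_generate_subset)
      show "sgrp_inv S x \<in> sgrp_generate T X" if "x \<in> sgrp_generate T X" for x
        using inv[of x] that sub sgrp_generate.inv[OF that] by auto
      show "x \<cdot>\<^bsub>S\<^esub> y \<in> sgrp_generate T X" if "x \<in> sgrp_generate T X" "y \<in> sgrp_generate T X" for x y
        using sgrp_generate.prod[OF that] by (simp add: sprod)
    qed (auto intro: sgrp_generate.incl)
    \<comment> \<open>The intersection with \<open>?C\<close> is carried along because the two unary
      operations are compared only there.\<close>
    have "sgrp_generate T X \<subseteq> sgrp_generate S X \<inter> ?C"
    proof (rule sgrp_generate_subset)
      show "sgrp_inv T x \<in> sgrp_generate S X \<inter> ?C" if "x \<in> sgrp_generate S X \<inter> ?C" for x
        using that inv[of x] sgrp_generate.inv[of x S] by (metis Int_iff)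
      show "x \<cdot>\<^bsub>T\<^esub> y \<in> sgrp_generate S X \<inter> ?C"
        if "x \<in> sgrp_generate S X \<inter> ?C" "y \<in> sgrp_generate S X \<inter> ?C" for x y
        using that sgrp_generate.prod[of x S _ y] by (simp add: sprod)
    qed (use X in \<open>auto intro: sgrp_generate.incl\<close>)
    then show "sgrp_generate T X \<subseteq> sgrp_generate S X" by blast
  qed
  have fg: "fg_cs_subsemigroup S A" if "fg_cs_subsemigroup T A" for A
    using that gen CS unfolding fg_cs_subsemigroup_def TS cT by (metis subset_trans)
  show ?thesis
    unfolding homogeneous_cs_def
  proof (intro conjI allI ballI impI csT)
    fix A B \<theta>
    assume "\<theta> \<in> sgrp_iso (T\<lparr>carrier := A\<rparr>) (T\<lparr>carrier := B\<rparr>)"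
      and "fg_cs_subsemigroup T A \<and> fg_cs_subsemigroup T B"
    then obtain \<phi> where \<phi>: "\<phi> \<in> sgrp_iso S S" "\<forall>x\<in>A. \<phi> x = \<theta> x"
      using hom fg unfolding homogeneous_cs_def TS by blast
    have "\<phi> ` ?C = ?C"
      using sgrp_iso_generate[OF crS \<phi>(1) ES] sgrp_iso_idempotents[OF completely_regular_semigroup[OF crS] \<phi>(1)]
      by simp
    then have "\<phi> \<in> sgrp_iso T T"
      using sgrp_iso_restrict[OF \<phi>(1) CS] by (simp add: T idempotent_generated_def)
    then show "\<exists>\<phi>\<in>sgrp_iso T T. \<forall>x\<in>A. \<phi> x = \<theta> x" using \<phi>(2) by blast
  qed
qed

section \<open>The two implications\<close>

theorem theorem5p2:
  fixes G :: "('g, 'b) monoid_scheme"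
    and I :: "'i set" and \<Lambda> :: "'l set" and P :: "'l \<Rightarrow> 'i \<Rightarrow> 'g"
  assumes "group G"
    and "countable (carrier G)" and "countable I" and "countable \<Lambda>"
    and "I \<noteq> {}" and "\<Lambda> \<noteq> {}"
    and "\<And>l i. l \<in> \<Lambda> \<Longrightarrow> i \<in> I \<Longrightarrow> P l i \<in> carrier G"
    and "normalised G I \<Lambda> P"
  defines "S \<equiv> rees_matrix_semigroup G I \<Lambda> P"
  shows "homogeneous_cs S \<longleftrightarrow>
    homogeneous_group G \<and> homogeneous_cs (idempotent_generated S) \<and>
    characteristic_subgroup (matrix_entries I \<Lambda> P) G"
proof -
  obtain i\<^sub>1 l\<^sub>1 where "i\<^sub>1 \<in> I" "l\<^sub>1 \<in> \<Lambda>" "\<forall>i\<in>I. P l\<^sub>1 i = \<one>\<^bsub>G\<^esub>" "\<forall>l\<in>\<Lambda>. P l i\<^sub>1 = \<one>\<^bsub>G\<^esub>"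
    using assms(8) unfolding normalised_def by blast
  then have "normalised_at G I \<Lambda> P i\<^sub>1 l\<^sub>1"
    using assms(7) by (simp add: normalised_at_def)
  with assms(1,7) interpret normalised_rees_matrix G I \<Lambda> P i\<^sub>1 l\<^sub>1
    by (simp add: normalised_rees_matrix_def normalised_rees_matrix_axioms_def
      rees_matrix_def rees_matrix_axioms_def)
  let ?N = "matrix_entries I \<Lambda> P"
  have PN: "P l i \<in> ?N" if "l \<in> \<Lambda>" "i \<in> I" for l i
    using that by (auto simp: matrix_entries_def)
  show ?thesis
  proof
    assume "homogeneous_cs S"
    then interpret homogeneous_rees_matrix G I \<Lambda> P i\<^sub>1 l\<^sub>1
      by unfold_locales (simp add: S_def)
    have N: "subgroup ?N G" using entries_characteristic by (simp add: characteristic_subgroup_def)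
    \<comment> \<open>With the entries known to form a subgroup, the idempotent-generated part is a
      Rees matrix semigroup over it, hence completely simple.\<close>
    interpret E: rees_matrix "G\<lparr>carrier := ?N\<rparr>" I \<Lambda> P
      using subgroup.subgroup_is_group[OF N is_group] PN
      by (simp add: rees_matrix_def rees_matrix_axioms_def)
    have "homogeneous_cs (idempotent_generated S)"
      unfolding S_def
      by (rule homogeneous_idempotent_generated[OF hom _ refl])
        (simp_all add: idempotent_generated_rees[OF N] rees_completely_regular
          E.rees_completely_simple[OF assms(5,6)] E.rees_completely_regular)
    then show "homogeneous_group G \<and> homogeneous_cs (idempotent_generated S) \<and>
        characteristic_subgroup ?N G"
      using homogeneous_group_of_rees entries_characteristic by blast
  next
    assume *: "homogeneous_group G \<and> homogeneous_cs (idempotent_generated S) \<and>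
        characteristic_subgroup ?N G"
    then have N: "subgroup ?N G" "\<And>\<beta>. \<beta> \<in> iso G G \<Longrightarrow> \<beta> ` ?N = ?N"
      by (auto simp: characteristic_subgroup_def)
    show "homogeneous_cs S"
      unfolding S_def
    proof (rule rees_homogeneousI[OF _ N(1) PN N(2) _ assms(3-6)])
      show "homogeneous_cs (rees (G\<lparr>carrier := ?N\<rparr>) I \<Lambda> P)"
        using * by (simp add: S_def idempotent_generated_rees[OF N(1)])
    qed (use * in auto)
  qed
qed

end
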